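(* Let $(X,g)$ be an $(n+1)$-dimensional semi-Riemannian $Spin$-manifold and $\iota:M\to X$ a hypersurface with induced metric $h=\iota^*g$, induced $Spin$-structure, unit normal vector field $N(g)$ and mean curvature $H(g)$. For $\lambda\in\mathbb{C}$ let $D_1(X,M;g,\lambda):\Gamma(S(X,g))\to\Gamma(S(X,g)|_M)$ be $$D_1(X,M;g,\lambda)\theta=N(g)\cdot\iota^*{\not\!\!D}^g\theta+(2\lambda+n)\,\iota^*\nabla^{g,S}_{N(g)}\theta+(2\lambda+n)(\lambda-\tfrac12)\,\iota^*H(g)\,\theta .$$ Let $\widehat g=e^{2\sigma}g$ with $\sigma\in C^\infty(X)$. Then for all $\theta\in\Gamma(S(X,g))$, $$e^{-(\lambda-1)\iota^*\sigma}\,D_1(X,M;\widehat g,\lambda)\big(e^{\lambda\sigma}\widehat\theta\big)=\widehat{D_1(X,M;g,\lambda)\theta}.$$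
   Context: Clifford multiplication satisfies $Y\cdot Z+Z\cdot Y=-2g(Y,Z)$. $S(X,g)$ is the spinor bundle, $\nabla^{g,S}$ the spinor connection induced by the Levi-Civita connection, ${\not\!\!D}^g=\sum_i\varepsilon_i s_i\cdot\nabla^{g,S}_{s_i}$ the Dirac operator (for an orthonormal frame with $g(s_i,s_j)=\varepsilon_i\delta_{ij}$). $\iota^*$ on spinors means restriction to $M$. Sign convention for the mean curvature: $W(Y)=-\nabla^g_YN(g)$ for $Y\in TM$ and $H(g)=\frac1n\mathrm{tr}(W)$. The unit normal for $\widehat g$ is chosen as $N(\widehat g)=e^{-\sigma}N(g)$. The hat on spinors: for $\widehat g=e^{2\sigma}g$, $\theta\mapsto\widehat\theta$ is the standard bundle isomorphism $S(X,g)\to S(X,\widehat g)$ (also used for the restrictions to $M$), compatible with Clifford multiplication via $(e^{-\sigma}Y)\,\widehat\cdot\,\widehat\theta=\widehat{Y\cdot\theta}$. *)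

theory Defs
  imports "HOL-Analysis.Analysis"
begin

section \<open>Smooth manifolds and tangent vectors\<close>

fun Ck_on :: "nat \<Rightarrow> 'a::euclidean_space set \<Rightarrow> ('a \<Rightarrow> 'b::real_normed_vector) \<Rightarrow> bool" where
  "Ck_on 0 S f \<longleftrightarrow> continuous_on S f"
| "Ck_on (Suc k) S f \<longleftrightarrow> (\<forall>x\<in>S. f differentiable (at x)) \<and>
     (\<forall>v. Ck_on k S (\<lambda>x. frechet_derivative f (at x) v))"

text \<open>Only used for open \<open>S\<close>.\<close>

definition smooth_on :: "'a::euclidean_space set \<Rightarrow> ('a \<Rightarrow> 'b::real_normed_vector) \<Rightarrow> bool" where
  "smooth_on S f \<longleftrightarrow> (\<forall>k. Ck_on k S f)"

type_synonym ('x, 'm) chart = "'x set \<times> ('x \<Rightarrow> real ^ 'm)"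

abbreviation chart_inv :: "('x, 'm::finite) chart \<Rightarrow> real ^ 'm \<Rightarrow> 'x" where
  "chart_inv c \<equiv> inv_into (fst c) (snd c)"

text \<open>The manifold is the whole type \<open>'x\<close>; Hausdorff and second countability are imposed as type
  class constraints in the theorem.\<close>

definition smooth_atlas :: "('x::topological_space, 'm::finite) chart set \<Rightarrow> bool" where
  "smooth_atlas A \<longleftrightarrow>
     (\<Union>c\<in>A. fst c) = UNIV \<and>
     (\<forall>c\<in>A. open (fst c) \<and> open (snd c ` fst c) \<and>
        homeomorphism (fst c) (snd c ` fst c) (snd c) (chart_inv c)) \<and>
     (\<forall>c\<in>A. \<forall>d\<in>A. smooth_on (snd c ` (fst c \<inter> fst d)) (snd d \<circ> chart_inv c))"

text \<open>A tangent vector at \<open>x\<close> is encoded by its components with respect to a chart around \<open>x\<close>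
  that is fixed once and for all by choice, \<open>chart_at A x\<close>. Since this chart varies with \<open>x\<close> in an
  uncontrolled way, smoothness and derivatives of tensor fields are always expressed after passing
  to components in one fixed chart \<open>c\<close>: the functions \<open>to_chart\<close> and \<open>from_chart\<close> below are the
  differentials of the coordinate changes.\<close>

definition chart_at :: "('x, 'm::finite) chart set \<Rightarrow> 'x \<Rightarrow> ('x, 'm) chart" where
  "chart_at A x = (SOME c. c \<in> A \<and> x \<in> fst c)"

definition coord_change ::
  "('x, 'm::finite) chart \<Rightarrow> ('x, 'm) chart \<Rightarrow> 'x \<Rightarrow> real ^ 'm \<Rightarrow> real ^ 'm" where
  "coord_change c d x = frechet_derivative (snd d \<circ> chart_inv c) (at (snd c x))"

definition to_chart ::
  "('x, 'm::finite) chart set \<Rightarrow> ('x, 'm) chart \<Rightarrow> 'x \<Rightarrow> real ^ 'm \<Rightarrow> real ^ 'm" where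
  "to_chart A c x = coord_change (chart_at A x) c x"

definition from_chart ::
  "('x, 'm::finite) chart set \<Rightarrow> ('x, 'm) chart \<Rightarrow> 'x \<Rightarrow> real ^ 'm \<Rightarrow> real ^ 'm" where
  "from_chart A c x = coord_change c (chart_at A x) x"

definition smooth_fun ::
  "('x, 'm::finite) chart set \<Rightarrow> 'x set \<Rightarrow> ('x \<Rightarrow> 'b::real_normed_vector) \<Rightarrow> bool" where
  "smooth_fun A V f \<longleftrightarrow> (\<forall>c\<in>A. smooth_on (snd c ` (fst c \<inter> V)) (f \<circ> chart_inv c))"

text \<open>\<open>dir_deriv A f x v\<close> is the derivative \<open>v(f)\<close> for \<open>v\<close> tangent at \<open>x\<close>.\<close>

definition dir_deriv ::
  "('x, 'm::finite) chart set \<Rightarrow> ('x \<Rightarrow> 'b::real_normed_vector) \<Rightarrow> 'x \<Rightarrow> real ^ 'm \<Rightarrow> 'b" where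
  "dir_deriv A f x v =
     frechet_derivative (f \<circ> chart_inv (chart_at A x)) (at (snd (chart_at A x) x)) v"

definition smooth_map ::
  "('y::topological_space, 'n::finite) chart set \<Rightarrow> ('x::topological_space, 'm::finite) chart set \<Rightarrow>
   ('y \<Rightarrow> 'x) \<Rightarrow> bool" where
  "smooth_map B A f \<longleftrightarrow> continuous_on UNIV f \<and>
     (\<forall>b\<in>B. \<forall>c\<in>A. smooth_on (snd b ` (fst b \<inter> f -` fst c)) (snd c \<circ> f \<circ> chart_inv b))"

definition differential ::
  "('y, 'n::finite) chart set \<Rightarrow> ('x, 'm::finite) chart set \<Rightarrow> ('y \<Rightarrow> 'x) \<Rightarrow> 'y \<Rightarrow>
   real ^ 'n \<Rightarrow> real ^ 'm" where
  "differential B A f y = dir_deriv B (snd (chart_at A (f y)) \<circ> f) y"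

text \<open>Smoothness, over the open set \<open>V\<close>, of a vector field \<open>Z\<close> along the map \<open>f\<close>, i.e. of a
  section of the pull-back bundle \<open>f\<^sup>*TX\<close>. Ordinary vector fields are the case \<open>f = id\<close>.\<close>

definition smooth_field_along ::
  "('y, 'n::finite) chart set \<Rightarrow> ('x, 'm::finite) chart set \<Rightarrow> ('y \<Rightarrow> 'x) \<Rightarrow> 'y set \<Rightarrow>
   ('y \<Rightarrow> real ^ 'm) \<Rightarrow> bool" where
  "smooth_field_along B A f V Z \<longleftrightarrow> (\<forall>b\<in>B. \<forall>c\<in>A.
     smooth_on (snd b ` (fst b \<inter> V \<inter> f -` fst c))
       ((\<lambda>y. to_chart A c (f y) (Z y)) \<circ> chart_inv b))"

section \<open>Semi-Riemannian metrics and the Levi-Civita connection\<close>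

type_synonym ('x, 'm) metric = "'x \<Rightarrow> real ^ 'm \<Rightarrow> real ^ 'm \<Rightarrow> real"

definition metric_coeff ::
  "('x, 'm::finite) chart set \<Rightarrow> ('x, 'm) metric \<Rightarrow> ('x, 'm) chart \<Rightarrow> 'x \<Rightarrow> real ^ 'm ^ 'm" where
  "metric_coeff A g c x =
     (\<chi> i j. g x (from_chart A c x (axis i 1)) (from_chart A c x (axis j 1)))"

text \<open>\<open>\<epsilon>\<close> lists the signs of the signature: at every point there is a basis with
  \<open>g(e\<^sub>i, e\<^sub>j) = \<epsilon>\<^sub>i \<delta>\<^sub>i\<^sub>j\<close>, which includes nondegeneracy.\<close>

definition semi_riemannian_metric ::
  "('x, 'm::finite) chart set \<Rightarrow> ('m \<Rightarrow> real) \<Rightarrow> ('x, 'm) metric \<Rightarrow> bool" where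
  "semi_riemannian_metric A \<epsilon> g \<longleftrightarrow>
     (\<forall>i. \<epsilon> i = 1 \<or> \<epsilon> i = -1) \<and>
     (\<forall>x. bilinear (g x) \<and> (\<forall>v w. g x v w = g x w v)) \<and>
     (\<forall>x. \<exists>e. \<forall>i j. g x (e i) (e j) = (if i = j then \<epsilon> i else 0)) \<and>
     (\<forall>c\<in>A. smooth_fun A (fst c) (metric_coeff A g c))"

text \<open>Christoffel symbols in the chart \<open>c\<close>:
  \<open>\<Gamma>\<^sup>k\<^sub>i\<^sub>j = 1/2 \<Sum>\<^sub>l g\<^sup>k\<^sup>l (\<partial>\<^sub>i g\<^sub>j\<^sub>l + \<partial>\<^sub>j g\<^sub>i\<^sub>l - \<partial>\<^sub>l g\<^sub>i\<^sub>j)\<close>.\<close>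

definition christoffel ::
  "('x, 'm::finite) chart set \<Rightarrow> ('x, 'm) metric \<Rightarrow> ('x, 'm) chart \<Rightarrow> 'x \<Rightarrow> 'm \<Rightarrow> 'm \<Rightarrow> 'm \<Rightarrow> real"
  where
  "christoffel A g c x k i j =
     (let G = metric_coeff A g c;
          dG = (\<lambda>a. frechet_derivative (G \<circ> chart_inv c) (at (snd c x)) (axis a 1))
      in 1/2 * (\<Sum>l\<in>UNIV. matrix_inv (G x) $ k $ l *
            (dG i $ j $ l + dG j $ i $ l - dG l $ i $ j)))"

text \<open>\<open>cov_along B A g f Z y u\<close> is \<open>\<nabla>\<^sub>u Z\<close> for the connection on \<open>f\<^sup>*TX\<close> pulled back from the
  Levi-Civita connection of \<open>(X, g)\<close>, where \<open>Z\<close> is a vector field along \<open>f : Y \<rightarrow> X\<close> and \<open>u\<close> is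
  tangent to \<open>Y\<close> at \<open>y\<close>. It is computed in the preferred chart at \<open>f y\<close>, so that the result needs no
  conversion of components.\<close>

definition cov_along ::
  "('y, 'n::finite) chart set \<Rightarrow> ('x, 'm::finite) chart set \<Rightarrow> ('x, 'm) metric \<Rightarrow> ('y \<Rightarrow> 'x) \<Rightarrow>
   ('y \<Rightarrow> real ^ 'm) \<Rightarrow> 'y \<Rightarrow> real ^ 'n \<Rightarrow> real ^ 'm" where
  "cov_along B A g f Z y u =
     (let c = chart_at A (f y)
      in dir_deriv B (\<lambda>z. to_chart A c (f z) (Z z)) y u +
         (\<chi> k. \<Sum>i\<in>UNIV. \<Sum>j\<in>UNIV.
            christoffel A g c (f y) k i j * differential B A f y u $ i * Z y $ j))"

definition levi_civita ::
  "('x, 'm::finite) chart set \<Rightarrow> ('x, 'm) metric \<Rightarrow> ('x \<Rightarrow> real ^ 'm) \<Rightarrow> 'x \<Rightarrow> real ^ 'm \<Rightarrow> real ^ 'm"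
  where
  "levi_civita A g = cov_along A A g (\<lambda>x. x)"

section \<open>The spin group\<close>

text \<open>\<open>\<gamma>\<close> are the Clifford matrices of the standard basis of \<open>\<real>\<^sup>p\<^sup>,\<^sup>q\<close> (signs \<open>\<epsilon>\<close>) acting on the spinor
  module \<open>\<Delta> = \<complex>\<^sup>k\<close>. With \<open>dim \<Delta> = 2 ^ (dim div 2)\<close> this is an irreducible complex Clifford module.\<close>

definition spinor_module :: "('m::finite \<Rightarrow> real) \<Rightarrow> ('m \<Rightarrow> complex ^ 'k ^ 'k::finite) \<Rightarrow> bool" where
  "spinor_module \<epsilon> \<gamma> \<longleftrightarrow>
     CARD('k) = 2 ^ (CARD('m) div 2) \<and>
     (\<forall>i j. \<gamma> i ** \<gamma> j + \<gamma> j ** \<gamma> i = (if i = j then -2 * \<epsilon> i else 0) *\<^sub>R mat 1)"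

definition cliff_mat :: "('m::finite \<Rightarrow> complex ^ 'k ^ 'k::finite) \<Rightarrow> real ^ 'm \<Rightarrow> complex ^ 'k ^ 'k"
  where
  "cliff_mat \<gamma> a = (\<Sum>i\<in>UNIV. a $ i *\<^sub>R \<gamma> i)"

text \<open>\<open>Spin(p,q)\<close>, the group of products of an even number of vectors of square norm \<open>\<plusminus>1\<close>. It lies
  in the even Clifford algebra, which acts faithfully on \<open>\<Delta>\<close> in every dimension, so the group is
  identified with its image in the matrices.\<close>

definition spin_group ::
  "('m::finite \<Rightarrow> real) \<Rightarrow> ('m \<Rightarrow> complex ^ 'k ^ 'k::finite) \<Rightarrow> (complex ^ 'k ^ 'k) set" where
  "spin_group \<epsilon> \<gamma> = {u. \<exists>as. even (length as) \<and>
     (\<forall>a\<in>set as. \<bar>\<Sum>i\<in>UNIV. \<epsilon> i * (a $ i)\<^sup>2\<bar> = 1) \<and>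
     u = foldr (\<lambda>a w. cliff_mat \<gamma> a ** w) as (mat 1)}"

text \<open>The two-fold covering \<open>Spin(p,q) \<rightarrow> SO(p,q)\<close>, determined by \<open>u \<cdot> a \<cdot> u\<inverse> = \<lambda>(u) a\<close>.\<close>

definition spin_cover ::
  "('m::finite \<Rightarrow> complex ^ 'k ^ 'k::finite) \<Rightarrow> complex ^ 'k ^ 'k \<Rightarrow> real ^ 'm ^ 'm" where
  "spin_cover \<gamma> u =
     (THE L. \<forall>a. u ** cliff_mat \<gamma> a ** matrix_inv u = cliff_mat \<gamma> (L *v a))"

section \<open>Spin manifolds and spinor fields\<close>

text \<open>A semi-Riemannian manifold with a spin structure. The spin structure is a principal
  \<open>Spin(p,q)\<close>-bundle with total space \<open>'q\<close>, projection \<open>proj\<close> and right action \<open>act\<close>, together with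
  an equivariant map \<open>frame\<close> to the bundle of orthonormal frames; \<open>frame X q i\<close> is the \<open>i\<close>-th vector
  of a frame at \<open>proj X q\<close>. The image of \<open>frame\<close> is an \<open>SO(p,q)\<close>-reduction of the bundle of orthonormal
  frames, i.e. the orientation is part of the data.\<close>

record ('x, 'm::finite, 'q, 'k::finite) spin_manifold =
  charts :: "('x, 'm) chart set"
  signs :: "'m \<Rightarrow> real"
  metric :: "('x, 'm) metric"
  gam :: "'m \<Rightarrow> complex ^ 'k ^ 'k"
  proj :: "'q \<Rightarrow> 'x"
  act :: "'q \<Rightarrow> complex ^ 'k ^ 'k \<Rightarrow> 'q"
  frame :: "'q \<Rightarrow> 'm \<Rightarrow> real ^ 'm"

abbreviation Spin ::
  "('x, 'm::finite, 'q, 'k::finite) spin_manifold \<Rightarrow> (complex ^ 'k ^ 'k) set" where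
  "Spin X \<equiv> spin_group (signs X) (gam X)"

text \<open>The smooth structure of the total space is the one for which \<open>frame\<close> is a local
  diffeomorphism onto its image. Hence a local section is smooth iff it is continuous and the
  underlying orthonormal frame is smooth.\<close>

definition smooth_section ::
  "('x::topological_space, 'm::finite, 'q::topological_space, 'k::finite) spin_manifold \<Rightarrow>
   'x set \<Rightarrow> ('x \<Rightarrow> 'q) \<Rightarrow> bool" where
  "smooth_section X V s \<longleftrightarrow> open V \<and> continuous_on V s \<and> (\<forall>x\<in>V. proj X (s x) = x) \<and>
     (\<forall>i. smooth_field_along (charts X) (charts X) (\<lambda>x. x) V (\<lambda>x. frame X (s x) i))"

definition spin_structure ::
  "('x::topological_space, 'm::finite, 'q::topological_space, 'k::finite) spin_manifold \<Rightarrow> bool" where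
  "spin_structure X \<longleftrightarrow>
     continuous_on UNIV (proj X) \<and>
     (\<forall>q. act X q (mat 1) = q) \<and>
     (\<forall>q. \<forall>u\<in>Spin X. \<forall>w\<in>Spin X. act X (act X q u) w = act X q (u ** w)) \<and>
     (\<forall>q. \<forall>u\<in>Spin X. proj X (act X q u) = proj X q) \<and>
     (\<forall>q i j. metric X (proj X q) (frame X q i) (frame X q j) = (if i = j then signs X i else 0)) \<and>
     (\<forall>q. \<forall>u\<in>Spin X. \<forall>j.
        frame X (act X q u) j = (\<Sum>i\<in>UNIV. spin_cover (gam X) u $ i $ j *\<^sub>R frame X q i)) \<and>
     (\<forall>x. \<exists>V s h. x \<in> V \<and> smooth_section X V s \<and>
        homeomorphism (V \<times> Spin X) (proj X -` V) (\<lambda>(z, u). act X (s z) u) h)"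

definition spin_mfd ::
  "('x::topological_space, 'm::finite, 'q::topological_space, 'k::finite) spin_manifold \<Rightarrow> bool" where
  "spin_mfd X \<longleftrightarrow>
     smooth_atlas (charts X) \<and>
     semi_riemannian_metric (charts X) (signs X) (metric X) \<and>
     spinor_module (signs X) (gam X) \<and>
     spin_structure X"

text \<open>The spinor bundle \<open>S(X,g)\<close> is the bundle associated with the spin structure and \<open>\<Delta>\<close>. The
  spinor \<open>[q, w]\<close> at \<open>proj X q\<close> is the class of \<open>(q, w)\<close> modulo \<open>(q\<cdot>u, w) \<sim> (q, u w)\<close>, so sections
  are the equivariant functions \<open>\<theta>\<close> on the total space, \<open>\<theta>(q\<cdot>u) = u\<inverse> \<theta>(q)\<close>; the section has the value
  \<open>[q, \<theta> q]\<close> at \<open>proj X q\<close>.\<close>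

definition spinor_field ::
  "('x::topological_space, 'm::finite, 'q::topological_space, 'k::finite) spin_manifold \<Rightarrow>
   ('q \<Rightarrow> complex ^ 'k) \<Rightarrow> bool" where
  "spinor_field X \<theta> \<longleftrightarrow>
     (\<forall>q. \<forall>u\<in>Spin X. \<theta> (act X q u) = matrix_inv u *v \<theta> q) \<and>
     (\<forall>V s. smooth_section X V s \<longrightarrow> smooth_fun (charts X) V (\<theta> \<circ> s))"

text \<open>Clifford multiplication by a tangent vector \<open>v\<close> at \<open>proj X q\<close>: \<open>v \<cdot> [q, w] = [q, clifford X q v w]\<close>,
  where \<open>\<epsilon>\<^sub>i g(v, s\<^sub>i)\<close> are the components of \<open>v\<close> in the frame \<open>s = frame X q\<close>.\<close>

definition clifford ::
  "('x, 'm::finite, 'q, 'k::finite) spin_manifold \<Rightarrow> 'q \<Rightarrow> real ^ 'm \<Rightarrow> complex ^ 'k \<Rightarrow> complex ^ 'k"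
  where
  "clifford X q v w =
     cliff_mat (gam X) (\<chi> i. signs X i * metric X (proj X q) v (frame X q i)) *v w"

text \<open>The spinor connection: if \<open>s\<close> is a local smooth section of the spin structure, with underlying
  orthonormal frame \<open>s\<^sub>1, \<dots>, s\<^sub>m\<close> and \<open>\<theta> = [s, \<theta> \<circ> s]\<close>, then
  \<open>\<nabla>\<^sub>v \<theta> = [s, v(\<theta> \<circ> s) + 1/4 \<Sum>\<^sub>k\<^sub>,\<^sub>l \<epsilon>\<^sub>k \<epsilon>\<^sub>l g(\<nabla>\<^sub>v s\<^sub>k, s\<^sub>l) \<gamma>\<^sub>k \<gamma>\<^sub>l (\<theta> \<circ> s)]\<close>.
  To obtain the value over \<open>q\<close> a section with \<open>s (proj X q) = q\<close> is chosen; the result does not depend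
  on that choice.\<close>

definition section_through ::
  "('x::topological_space, 'm::finite, 'q::topological_space, 'k::finite) spin_manifold \<Rightarrow>
   'q \<Rightarrow> 'x \<Rightarrow> 'q" where
  "section_through X q =
     (SOME s. s (proj X q) = q \<and> (\<exists>V. proj X q \<in> V \<and> smooth_section X V s))"

definition spin_conn ::
  "('x::topological_space, 'm::finite, 'q::topological_space, 'k::finite) spin_manifold \<Rightarrow>
   ('q \<Rightarrow> complex ^ 'k) \<Rightarrow> 'q \<Rightarrow> real ^ 'm \<Rightarrow> complex ^ 'k" where
  "spin_conn X \<theta> q v =
     (let x = proj X q; s = section_through X q;
          \<omega> = (\<lambda>k l. metric X x
                 (levi_civita (charts X) (metric X) (\<lambda>z. frame X (s z) k) x v) (frame X q l))
      in dir_deriv (charts X) (\<theta> \<circ> s) x v +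
         (1/4) *\<^sub>R (\<Sum>k\<in>UNIV. \<Sum>l\<in>UNIV.
            (signs X k * signs X l * \<omega> k l) *\<^sub>R (gam X k *v (gam X l *v \<theta> q))))"

definition dirac ::
  "('x::topological_space, 'm::finite, 'q::topological_space, 'k::finite) spin_manifold \<Rightarrow>
   ('q \<Rightarrow> complex ^ 'k) \<Rightarrow> 'q \<Rightarrow> complex ^ 'k" where
  "dirac X \<theta> q =
     (\<Sum>i\<in>UNIV. signs X i *\<^sub>R clifford X q (frame X q i) (spin_conn X \<theta> q (frame X q i)))"

section \<open>Hypersurfaces\<close>

record ('x, 'm::finite, 'y, 'n::finite) hypersurface =
  hcharts :: "('y, 'n) chart set"
  emb :: "'y \<Rightarrow> 'x"
  normal :: "'y \<Rightarrow> real ^ 'm"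

definition induced_metric ::
  "('x, 'm::finite, 'q, 'k::finite) spin_manifold \<Rightarrow> ('x, 'm, 'y, 'n::finite) hypersurface \<Rightarrow>
   ('y, 'n) metric" where
  "induced_metric X M y u v =
     metric X (emb M y) (differential (hcharts M) (charts X) (emb M) y u)
       (differential (hcharts M) (charts X) (emb M) y v)"

definition unit_normal ::
  "('x::topological_space, 'm::finite, 'q, 'k::finite) spin_manifold \<Rightarrow>
   ('x, 'm, 'y::topological_space, 'n::finite) hypersurface \<Rightarrow> bool" where
  "unit_normal X M \<longleftrightarrow>
     smooth_field_along (hcharts M) (charts X) (emb M) UNIV (normal M) \<and>
     (\<forall>y u. metric X (emb M y) (normal M y)
        (differential (hcharts M) (charts X) (emb M) y u) = 0) \<and>
     (\<forall>y. \<bar>metric X (emb M y) (normal M y) (normal M y)\<bar> = 1)"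

definition hypersurface_in ::
  "('x::topological_space, 'm::finite, 'q, 'k::finite) spin_manifold \<Rightarrow>
   ('x, 'm, 'y::topological_space, 'n::finite) hypersurface \<Rightarrow> bool" where
  "hypersurface_in X M \<longleftrightarrow>
     CARD('m) = CARD('n) + 1 \<and>
     smooth_atlas (hcharts M) \<and>
     smooth_map (hcharts M) (charts X) (emb M) \<and>
     (\<forall>y. inj (differential (hcharts M) (charts X) (emb M) y)) \<and>
     homeomorphism UNIV (range (emb M)) (emb M) (inv (emb M)) \<and>
     (\<exists>\<delta>. semi_riemannian_metric (hcharts M) \<delta> (induced_metric X M)) \<and>
     unit_normal X M"

text \<open>\<open>W(u) = - \<nabla>\<^sub>u N\<close> is tangent to the hypersurface; \<open>inv (d\<iota>)\<close> turns it into a vector in \<open>T\<^sub>yM\<close>.\<close>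

definition weingarten ::
  "('x, 'm::finite, 'q, 'k::finite) spin_manifold \<Rightarrow> ('x, 'm, 'y, 'n::finite) hypersurface \<Rightarrow>
   'y \<Rightarrow> real ^ 'n \<Rightarrow> real ^ 'n" where
  "weingarten X M y u =
     inv (differential (hcharts M) (charts X) (emb M) y)
       (- cov_along (hcharts M) (charts X) (metric X) (emb M) (normal M) y u)"

definition mean_curvature ::
  "('x, 'm::finite, 'q, 'k::finite) spin_manifold \<Rightarrow> ('x, 'm, 'y, 'n::finite) hypersurface \<Rightarrow>
   'y \<Rightarrow> real" where
  "mean_curvature X M y = 1 / real CARD('n) * trace (matrix (weingarten X M y))"

text \<open>Sections of \<open>S(X,g)|\<^sub>M = \<iota>\<^sup>*S(X,g)\<close> are functions of \<open>(y, q)\<close> with \<open>proj X q = emb M y\<close>, and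
  \<open>\<iota>\<^sup>*\<theta>\<close> is \<open>(y, q) \<mapsto> \<theta> q\<close>. Values at other pairs are irrelevant.\<close>

definition D1 ::
  "('x::topological_space, 'm::finite, 'q::topological_space, 'k::finite) spin_manifold \<Rightarrow>
   ('x, 'm, 'y, 'n::finite) hypersurface \<Rightarrow> complex \<Rightarrow> ('q \<Rightarrow> complex ^ 'k) \<Rightarrow>
   'y \<times> 'q \<Rightarrow> complex ^ 'k" where
  "D1 X M lam \<theta> = (\<lambda>(y, q).
     let n = of_nat CARD('n)
     in clifford X q (normal M y) (dirac X \<theta> q) +
        (2 * lam + n) *s spin_conn X \<theta> q (normal M y) +
        ((2 * lam + n) * (lam - 1/2) * of_real (mean_curvature X M y)) *s \<theta> q)"

section \<open>Conformal change\<close>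

text \<open>The spin manifold \<open>(X, e\<^sup>2\<^sup>\<sigma>g)\<close> and the hypersurface with \<open>N(e\<^sup>2\<^sup>\<sigma>g) = e\<^sup>-\<^sup>\<sigma>N(g)\<close>. The corresponding
  spin structure is the same principal bundle, with every frame rescaled by \<open>e\<^sup>-\<^sup>\<sigma>\<close>.\<close>

definition conformal :: "('x \<Rightarrow> real) \<Rightarrow> ('x, 'm::finite, 'q, 'k::finite) spin_manifold \<Rightarrow>
   ('x, 'm, 'q, 'k) spin_manifold" where
  "conformal \<sigma> X = X\<lparr>metric := (\<lambda>x v w. exp (2 * \<sigma> x) * metric X x v w),
     frame := (\<lambda>q i. exp (- \<sigma> (proj X q)) *\<^sub>R frame X q i)\<rparr>"

definition conformal_hyp :: "('x \<Rightarrow> real) \<Rightarrow> ('x, 'm::finite, 'y, 'n::finite) hypersurface \<Rightarrow>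
   ('x, 'm, 'y, 'n) hypersurface" where
  "conformal_hyp \<sigma> M = M\<lparr>normal := (\<lambda>y. exp (- \<sigma> (emb M y)) *\<^sub>R normal M y)\<rparr>"

text \<open>The isomorphism \<open>S(X,g) \<rightarrow> S(X,e\<^sup>2\<^sup>\<sigma>g)\<close> sends the class \<open>[q, w]\<close>, with \<open>w\<close> the components of a spinor
  relative to the frame \<open>s = frame X q\<close>, to the class \<open>[q, w]\<close>, now with \<open>w\<close> the components relative to
  the frame \<open>e\<^sup>-\<^sup>\<sigma>s\<close>. On sections written as equivariant functions it therefore leaves the function
  unchanged; this covers sections over \<open>X\<close> (\<open>'s = 'q\<close>) and over \<open>M\<close> (\<open>'s = 'y \<times> 'q\<close>). The geometric
  content is in the change of \<open>frame\<close>, see \<open>clifford_conformal\<close>.\<close>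

definition hat :: "('s \<Rightarrow> complex ^ 'k::finite) \<Rightarrow> 's \<Rightarrow> complex ^ 'k" where
  "hat \<theta> q = \<theta> q"

lemma clifford_conformal:
  fixes X :: "('x::topological_space, 'm::finite, 'q::topological_space, 'k::finite) spin_manifold"
  assumes "spin_mfd X"
  shows "clifford (conformal \<sigma> X) q (exp (- \<sigma> (proj X q)) *\<^sub>R v) (hat \<theta> q)
       = hat (\<lambda>p. clifford X p v (\<theta> p)) q"
proof -
  have b: "bilinear (metric X (proj X q))"
    using assms by (simp add: spin_mfd_def semi_riemannian_metric_def)
  have e: "exp (2 * a) * (exp (- a) * (exp (- a) * r)) = r" for a r :: real
  proof -
    have "exp (2 * a) * (exp (- a) * (exp (- a) * r)) = exp (2 * a + (- a) + (- a)) * r"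
      by (simp only: exp_add mult.assoc)
    then show ?thesis by simp
  qed
  show ?thesis
    by (simp add: clifford_def conformal_def hat_def bilinear_lmul[OF b] bilinear_rmul[OF b] e)
qed

section \<open>The conformally changed data form a spin manifold\<close>

lemma Ck_on_cong:
  "open S \<Longrightarrow> (\<And>x. x \<in> S \<Longrightarrow> f x = g x) \<Longrightarrow> Ck_on k S f \<longleftrightarrow> Ck_on k S g"
proof (induction k arbitrary: f g)
  case 0 then show ?case by (simp cong: continuous_on_cong)
next
  case (Suc k)
  have d: "(f has_derivative f') (at x) \<longleftrightarrow> (g has_derivative f') (at x)" if "x \<in> S" for x f'
    using has_derivative_transform_within_open[of f f' x UNIV S g]
      has_derivative_transform_within_open[of g f' x UNIV S f] Suc.prems that by force
  have fd: "frechet_derivative f (at x) = frechet_derivative g (at x)" if "x \<in> S" for x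
    unfolding frechet_derivative_def using d[OF that] by simp
  show ?case
    using Suc.IH[OF Suc.prems(1), of "\<lambda>x. frechet_derivative f (at x) v" "\<lambda>x. frechet_derivative g (at x) v" for v]
    by (simp add: fd differentiable_def d)
qed

lemma Ck_on_continuous: "Ck_on k S f \<Longrightarrow> continuous_on S f"
  by (cases k) (simp_all add: differentiable_imp_continuous_within continuous_at_imp_continuous_on)

lemma Ck_on_pred: "Ck_on (Suc k) S f \<Longrightarrow> Ck_on k S f"
proof (induction k arbitrary: f)
  case 0 then show ?case by (simp add: differentiable_imp_continuous_within continuous_at_imp_continuous_on)
next
  case (Suc k)
  have "\<forall>x\<in>S. f differentiable (at x)" "Ck_on k S (\<lambda>x. frechet_derivative f (at x) v)" for v
    using Suc.prems Suc.IH unfolding Ck_on.simps(2)[of "Suc k"] by blast+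
  then show ?case by simp
qed

lemma Ck_on_add:
  "open S \<Longrightarrow> Ck_on k S f \<Longrightarrow> Ck_on k S g \<Longrightarrow> Ck_on k S (\<lambda>x. f x + g x)"
proof (induction k arbitrary: f g)
  case 0 then show ?case by (auto intro: continuous_intros)
next
  case (Suc k)
  have fd: "frechet_derivative (\<lambda>x. f x + g x) (at x) v
      = frechet_derivative f (at x) v + frechet_derivative g (at x) v" if "x \<in> S" for x v
  proof -
    have "((\<lambda>x. f x + g x) has_derivative
       (\<lambda>v. frechet_derivative f (at x) v + frechet_derivative g (at x) v)) (at x)"
      using Suc.prems that
      by (intro has_derivative_add) (auto simp: frechet_derivative_works[symmetric])
    from fun_cong[OF frechet_derivative_at[OF this], of v] show ?thesis by simp
  qed
  have "Ck_on k S (\<lambda>x. frechet_derivative f (at x) v + frechet_derivative g (at x) v)" for v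
    using Suc by auto
  then show ?case using Suc.prems
    by (auto simp: Ck_on_cong[OF Suc.prems(1) fd])
qed

lemma Ck_on_scaleR:
  fixes f :: "'a::euclidean_space \<Rightarrow> real"
  shows "open S \<Longrightarrow> Ck_on k S f \<Longrightarrow> Ck_on k S g \<Longrightarrow> Ck_on k S (\<lambda>x. f x *\<^sub>R g x)"
proof (induction k arbitrary: f g)
  case 0 then show ?case by (auto intro: continuous_intros)
next
  case (Suc k)
  have d: "((\<lambda>x. f x *\<^sub>R g x) has_derivative
     (\<lambda>v. f x *\<^sub>R frechet_derivative g (at x) v + frechet_derivative f (at x) v *\<^sub>R g x)) (at x)"
    if "x \<in> S" for x
    using Suc.prems that
    by (intro has_derivative_scaleR) (auto simp: frechet_derivative_works[symmetric])
  have fd: "frechet_derivative (\<lambda>x. f x *\<^sub>R g x) (at x) v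
      = f x *\<^sub>R frechet_derivative g (at x) v + frechet_derivative f (at x) v *\<^sub>R g x" if "x \<in> S" for x v
    by (rule fun_cong[OF frechet_derivative_at[OF d[OF that]], symmetric])
  have "Ck_on k S (\<lambda>x. f x *\<^sub>R frechet_derivative g (at x) v + frechet_derivative f (at x) v *\<^sub>R g x)" for v
    using Suc.prems Ck_on_pred[OF Suc.prems(2)] Ck_on_pred[OF Suc.prems(3)] by (intro Ck_on_add Suc.IH) auto
  then show ?case using d
    by (auto simp: Ck_on_cong[OF Suc.prems(1) fd] differentiable_def)
qed

lemma Ck_on_exp:
  fixes f :: "'a::euclidean_space \<Rightarrow> real"
  shows "open S \<Longrightarrow> Ck_on k S f \<Longrightarrow> Ck_on k S (\<lambda>x. exp (c * f x))"
proof (induction k arbitrary: f)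
  case 0 then show ?case by (auto intro!: continuous_intros)
next
  case (Suc k)
  have d: "((\<lambda>x. exp (c * f x)) has_derivative
     (\<lambda>v. exp (c * f x) *\<^sub>R (c *\<^sub>R frechet_derivative f (at x) v))) (at x)"
    if "x \<in> S" for x
    using Suc.prems that frechet_derivative_works[of f "at x"]
    by (auto intro!: derivative_eq_intros)
  have fd: "frechet_derivative (\<lambda>x. exp (c * f x)) (at x) v
      = exp (c * f x) *\<^sub>R (c *\<^sub>R frechet_derivative f (at x) v)" if "x \<in> S" for x v
    by (rule fun_cong[OF frechet_derivative_at[OF d[OF that]], symmetric])
  have const: "Ck_on j S (\<lambda>x. c)" for j
    by (induction j arbitrary: c) auto
  have "Ck_on k S (\<lambda>x. exp (c * f x) *\<^sub>R (c *\<^sub>R frechet_derivative f (at x) v))" for v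
    using Suc.prems const Ck_on_pred[OF Suc.prems(2)] by (intro Ck_on_scaleR Suc.IH) auto
  then show ?case using d
    by (auto simp: Ck_on_cong[OF Suc.prems(1) fd] differentiable_def)
qed

lemma chart_at_mem:
  assumes "smooth_atlas A" shows "chart_at A x \<in> A" "x \<in> fst (chart_at A x)"
proof -
  have "\<exists>c. c \<in> A \<and> x \<in> fst c" using assms unfolding smooth_atlas_def by blast
  from someI_ex[OF this] show "chart_at A x \<in> A" "x \<in> fst (chart_at A x)"
    unfolding chart_at_def by auto
qed

lemma open_chart_image:
  assumes "smooth_atlas A" "c \<in> A" "open V" shows "open (snd c ` (fst c \<inter> V))"
proof -
  have h: "homeomorphism (fst c) (snd c ` fst c) (snd c) (chart_inv c)" "open (snd c ` fst c)"
    "open (fst c)"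
    using assms unfolding smooth_atlas_def by auto
  have "openin (top_of_set (fst c)) (fst c \<inter> V)" using assms(3) by (rule openin_open_Int)
  from homeomorphism_imp_open_map[OF h(1) this] h(2) show ?thesis
    by (metis openin_open_eq)
qed

lemma chart_inv_chart: "smooth_atlas A \<Longrightarrow> c \<in> A \<Longrightarrow> x \<in> fst c \<Longrightarrow> chart_inv c (snd c x) = x"
  unfolding smooth_atlas_def homeomorphism_def by blast

lemma linear_coord_change:
  assumes "smooth_atlas A" "c \<in> A" "d \<in> A" "x \<in> fst c" "x \<in> fst d"
  shows "linear (coord_change c d x)"
proof -
  have "Ck_on (Suc 0) (snd c ` (fst c \<inter> fst d)) (snd d \<circ> chart_inv c)"
    using assms unfolding smooth_atlas_def smooth_on_def by blast
  then have "(snd d \<circ> chart_inv c) differentiable (at (snd c x))" using assms by auto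
  then show ?thesis unfolding coord_change_def by (rule linear_frechet_derivative)
qed

lemma linear_to_chart:
  assumes "smooth_atlas A" "c \<in> A" "x \<in> fst c" shows "linear (to_chart A c x)"
  unfolding to_chart_def using assms chart_at_mem[OF assms(1)] by (intro linear_coord_change) auto

lemma smooth_on_exp_scaleR:
  assumes "open S" "smooth_on S f" "smooth_on S g"
  shows "smooth_on S (\<lambda>x. exp (c * f x) *\<^sub>R g x)"
  using assms unfolding smooth_on_def by (auto intro!: Ck_on_scaleR Ck_on_exp)

lemma smooth_on_cong: "open S \<Longrightarrow> (\<And>x. x \<in> S \<Longrightarrow> f x = g x) \<Longrightarrow> smooth_on S f \<longleftrightarrow> smooth_on S g"
  unfolding smooth_on_def using Ck_on_cong by blast

lemma Ck_on_subset: "Ck_on k S f \<Longrightarrow> T \<subseteq> S \<Longrightarrow> Ck_on k T f"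
  by (induction k arbitrary: f) (auto intro: continuous_on_subset)

lemma smooth_on_subset: "smooth_on S f \<Longrightarrow> T \<subseteq> S \<Longrightarrow> smooth_on T f"
  unfolding smooth_on_def using Ck_on_subset by blast

lemma smooth_field_scale:
  assumes A: "smooth_atlas A" and s: "smooth_fun A UNIV \<sigma>" and V: "open V"
    and Z: "smooth_field_along A A (\<lambda>x. x) V Z"
  shows "smooth_field_along A A (\<lambda>x. x) V (\<lambda>x. exp (c * \<sigma> x) *\<^sub>R Z x)"
  unfolding smooth_field_along_def
proof (intro ballI)
  fix b d assume b: "b \<in> A" and d: "d \<in> A"
  let ?S = "snd b ` (fst b \<inter> V \<inter> (\<lambda>x. x) -` fst d)"
  have "open (fst d)" using A d unfolding smooth_atlas_def by auto
  then have o: "open ?S" using open_chart_image[OF A b, of "V \<inter> fst d"] V by (simp add: Int_assoc open_Int)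
  have "smooth_on (snd b ` fst b) (\<sigma> \<circ> chart_inv b)" using s b unfolding smooth_fun_def by auto
  then have 1: "smooth_on ?S (\<sigma> \<circ> chart_inv b)" by (rule smooth_on_subset) auto
  have 2: "smooth_on ?S ((\<lambda>y. to_chart A d y (Z y)) \<circ> chart_inv b)"
    using Z b d unfolding smooth_field_along_def by blast
  have "smooth_on ?S (\<lambda>u. exp (c * (\<sigma> \<circ> chart_inv b) u) *\<^sub>R ((\<lambda>y. to_chart A d y (Z y)) \<circ> chart_inv b) u)"
    by (rule smooth_on_exp_scaleR[OF o 1 2])
  moreover have "exp (c * (\<sigma> \<circ> chart_inv b) u) *\<^sub>R ((\<lambda>y. to_chart A d y (Z y)) \<circ> chart_inv b) u
     = ((\<lambda>y. to_chart A d y (exp (c * \<sigma> y) *\<^sub>R Z y)) \<circ> chart_inv b) u" if "u \<in> ?S" for u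
  proof -
    have "chart_inv b u \<in> fst d" using that chart_inv_chart[OF A b] by auto
    from linear_scale[OF linear_to_chart[OF A d this]] show ?thesis by simp
  qed
  ultimately show "smooth_on ?S ((\<lambda>y. to_chart A d y (exp (c * \<sigma> y) *\<^sub>R Z y)) \<circ> chart_inv b)"
    using smooth_on_cong[OF o] by (metis (no_types, lifting))
qed

lemma spin_mfd_conformal:
  fixes X :: "('x::topological_space, 'm::finite, 'q::topological_space, 'k::finite) spin_manifold"
  assumes X: "spin_mfd X" and s: "smooth_fun (charts X) UNIV \<sigma>"
  shows "spin_mfd (conformal \<sigma> X)"
proof -
  let ?A = "charts X" and ?g = "metric X" and ?h = "\<lambda>x v w. exp (2 * \<sigma> x) * metric X x v w"
  have A: "smooth_atlas ?A" and G: "semi_riemannian_metric ?A (signs X) ?g" and P: "spin_structure X"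
    using X by (auto simp: spin_mfd_def)
  have bil: "bilinear (?g x)" for x using G by (simp add: semi_riemannian_metric_def)
  have e: "exp (2 * a) * (exp (- a) * (exp (- a) * r)) = r" for a r :: real
  proof -
    have "exp (2 * a) * (exp (- a) * (exp (- a) * r)) = exp (2 * a + (- a) + (- a)) * r"
      by (simp only: exp_add mult.assoc)
    then show ?thesis by simp
  qed
  have bh: "bilinear (?h x)" for x
    using bil[of x] by (simp add: bilinear_def linear_iff ring_distribs)
  have ex: "\<exists>e. \<forall>i j. ?h x (e i) (e j) = (if i = j then signs X i else 0)" for x
  proof -
    obtain e where "\<And>i j. ?g x (e i) (e j) = (if i = j then signs X i else 0)"
      using G unfolding semi_riemannian_metric_def by metis
    then show ?thesis
      by (intro exI[of _ "\<lambda>i. exp (- \<sigma> x) *\<^sub>R e i"])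
        (simp add: bilinear_lmul[OF bil] bilinear_rmul[OF bil] e)
  qed
  have mc: "metric_coeff ?A ?h c x = exp (2 * \<sigma> x) *\<^sub>R metric_coeff ?A ?g c x" for c x
    by (simp add: metric_coeff_def vec_eq_iff)
  have sm: "smooth_fun ?A (fst c) (metric_coeff ?A ?h c)" if "c \<in> ?A" for c
    unfolding smooth_fun_def
  proof
    fix d assume d: "d \<in> ?A"
    let ?S = "snd d ` (fst d \<inter> fst c)"
    have o: "open ?S" using that A by (intro open_chart_image[OF A d]) (auto simp: smooth_atlas_def)
    have "smooth_on (snd d ` fst d) (\<sigma> \<circ> chart_inv d)" using s d unfolding smooth_fun_def by auto
    then have 1: "smooth_on ?S (\<sigma> \<circ> chart_inv d)" by (rule smooth_on_subset) auto
    have 2: "smooth_on ?S (metric_coeff ?A ?g c \<circ> chart_inv d)"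
      using G that d unfolding semi_riemannian_metric_def smooth_fun_def by blast
    from smooth_on_exp_scaleR[OF o 1 2, of 2]
    show "smooth_on ?S (metric_coeff ?A ?h c \<circ> chart_inv d)"
      by (simp add: mc comp_def)
  qed
  have G': "semi_riemannian_metric ?A (signs X) ?h"
    using G bh ex sm unfolding semi_riemannian_metric_def by auto
  have sec: "smooth_section (conformal \<sigma> X) V t" if t: "smooth_section X V t" for V t
  proof -
    have "smooth_field_along ?A ?A (\<lambda>x. x) V (\<lambda>x. exp (- \<sigma> (proj X (t x))) *\<^sub>R frame X (t x) i)" for i
    proof -
      have "smooth_field_along ?A ?A (\<lambda>x. x) V (\<lambda>x. exp (-1 * \<sigma> x) *\<^sub>R frame X (t x) i)"
        using t by (intro smooth_field_scale[OF A s]) (auto simp: smooth_section_def)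
      moreover have "to_chart ?A c y (exp (- \<sigma> (proj X (t y))) *\<^sub>R frame X (t y) i)
         = to_chart ?A c y (exp (-1 * \<sigma> y) *\<^sub>R frame X (t y) i)" if "y \<in> V" for c y
        using t that by (simp add: smooth_section_def)
      ultimately show ?thesis unfolding smooth_field_along_def
      proof (intro ballI, goal_cases)
        case (1 b c)
        let ?S = "snd b ` (fst b \<inter> V \<inter> (\<lambda>x. x) -` fst c)"
        have "open (fst c)" "open V" using A 1 t unfolding smooth_atlas_def smooth_section_def by auto
        then have o: "open ?S" using open_chart_image[OF A 1(3), of "V \<inter> fst c"]
          by (simp add: Int_assoc open_Int)
        have "chart_inv b u \<in> V" if "u \<in> ?S" for u using that chart_inv_chart[OF A 1(3)] by auto
        then have eq: "((\<lambda>y. to_chart ?A c y (exp (-1 * \<sigma> y) *\<^sub>R frame X (t y) i)) \<circ> chart_inv b) u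
            = ((\<lambda>y. to_chart ?A c y (exp (- \<sigma> (proj X (t y))) *\<^sub>R frame X (t y) i)) \<circ> chart_inv b) u"
          if "u \<in> ?S" for u using 1(2) that by simp
        have sm1: "smooth_on ?S ((\<lambda>y. to_chart ?A c y (exp (-1 * \<sigma> y) *\<^sub>R frame X (t y) i)) \<circ> chart_inv b)"
          using 1(1,3,4) by blast
        show ?case by (rule smooth_on_cong[OF o, THEN iffD1, rotated], rule sm1, rule eq)
      qed
    qed
    then show ?thesis using t by (simp add: smooth_section_def conformal_def)
  qed
  have "spin_structure (conformal \<sigma> X)"
    unfolding spin_structure_def
  proof (intro conjI allI ballI)
    fix x
    obtain V t k where "x \<in> V" "smooth_section X V t"
      "homeomorphism (V \<times> Spin X) (proj X -` V) (\<lambda>(z, u). act X (t z) u) k"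
      using P unfolding spin_structure_def by meson
    then show "\<exists>V t k. x \<in> V \<and> smooth_section (conformal \<sigma> X) V t \<and>
      homeomorphism (V \<times> Spin (conformal \<sigma> X)) (proj (conformal \<sigma> X) -` V)
        (\<lambda>(z, u). act (conformal \<sigma> X) (t z) u) k"
      using sec by (intro exI[of _ V] exI[of _ t] exI[of _ k]) (simp add: conformal_def)
  next
    fix q i j
    show "metric (conformal \<sigma> X) (proj (conformal \<sigma> X) q) (frame (conformal \<sigma> X) q i)
       (frame (conformal \<sigma> X) q j) = (if i = j then signs (conformal \<sigma> X) i else 0)"
      using P by (simp add: spin_structure_def conformal_def bilinear_lmul[OF bil] bilinear_rmul[OF bil] e)
  next
    fix q u j assume "u \<in> Spin (conformal \<sigma> X)"
    then have "u \<in> Spin X" by (simp add: conformal_def)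
    then have "frame X (act X q u) j = (\<Sum>i\<in>UNIV. spin_cover (gam X) u $ i $ j *\<^sub>R frame X q i)"
      and "proj X (act X q u) = proj X q"
      using P unfolding spin_structure_def by blast+
    then show "frame (conformal \<sigma> X) (act (conformal \<sigma> X) q u) j
       = (\<Sum>i\<in>UNIV. spin_cover (gam (conformal \<sigma> X)) u $ i $ j *\<^sub>R frame (conformal \<sigma> X) q i)"
      by (simp add: conformal_def scaleR_sum_right mult.commute)
  qed (use P in \<open>simp_all add: spin_structure_def conformal_def\<close>)
  then show ?thesis using X G' by (simp add: spin_mfd_def conformal_def)
qed

end

theory Submission
  imports Defs
begin

text \<open>Let \<open>G\<close> be the gradient of \<open>\<sigma>\<close> with respect to \<open>g\<close>. By the formula for the
  Christoffel symbols, the derivative of \<open>e\<^sup>-\<^sup>\<sigma>Z\<close> along \<open>v\<close> for the Levi-Civita connection of \<open>e\<^sup>2\<^sup>\<sigma>g\<close> is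
  \<open>e\<^sup>-\<^sup>\<sigma>(\<nabla>\<^sub>vZ + d\<sigma>(Z)v - g(v,Z)G)\<close>. Applied to the normal field this
  changes \<open>H\<close> into \<open>e\<^sup>-\<^sup>\<sigma>(H - d\<sigma>(N))\<close>; applied to an orthonormal frame it changes the spinor
  derivative \<open>\<nabla>\<^sub>v\<theta>\<close>, after weighting \<open>\<theta>\<close> by \<open>e\<^sup>\<lambda>\<^sup>\<sigma>\<close>, into
  \<open>e\<^sup>\<lambda>\<^sup>\<sigma>(\<nabla>\<^sub>v\<theta> - 1/2 v\<cdot>G\<cdot>\<theta> + (\<lambda> - 1/2)d\<sigma>(v)\<theta>)\<close>, and contracting with the frame changes the Dirac
  operator \<open>D\<theta>\<close> into \<open>e\<^sup>(\<^sup>\<lambda>\<^sup>-\<^sup>1\<^sup>)\<^sup>\<sigma>(D\<theta> + (\<lambda> + n/2)G\<cdot>\<theta>)\<close>. In the combination \<open>D\<^sub>1\<close> the terms in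
  \<open>N\<cdot>G\<cdot>\<theta>\<close> and those in \<open>d\<sigma>(N)\<theta>\<close> cancel.\<close>

section \<open>Directional derivatives in the preferred charts\<close>

text \<open>\<open>dir_deriv\<close> is a total function whose value is uninformative where no
  derivative exists. This relation carries existence together with the value, so that product and
  chain rules can be composed.\<close>

definition has_dir_deriv ::
  "('x, 'm::finite) chart set \<Rightarrow> ('x \<Rightarrow> 'b::real_normed_vector) \<Rightarrow> 'x \<Rightarrow> (real ^ 'm \<Rightarrow> 'b) \<Rightarrow> bool" where
  "has_dir_deriv A F x D \<longleftrightarrow>
     (F \<circ> chart_inv (chart_at A x) has_derivative D) (at (snd (chart_at A x) x))"

lemma has_dir_deriv_eq: "has_dir_deriv A F x D \<Longrightarrow> dir_deriv A F x = D"
  unfolding has_dir_deriv_def dir_deriv_def using frechet_derivative_at by fastforce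

lemma has_dir_deriv_linear: "has_dir_deriv A F x D \<Longrightarrow> linear D"
  unfolding has_dir_deriv_def by (rule has_derivative_linear)

lemma differentiable_smooth_on:
  assumes "smooth_on S F" "p \<in> S" shows "F differentiable (at p)"
proof -
  have "Ck_on (Suc 0) S F" using assms(1) unfolding smooth_on_def by blast
  then show ?thesis using assms(2) by simp
qed

lemma has_dir_deriv_differentiable:
  assumes "(F \<circ> chart_inv (chart_at A x)) differentiable (at (snd (chart_at A x) x))"
  shows "has_dir_deriv A F x (dir_deriv A F x)"
  using assms frechet_derivative_works unfolding has_dir_deriv_def dir_deriv_def by blast

text \<open>Coordinate formulas agree with the intrinsic objects only on chart or section domains.
  Derivatives are local, and this transfers them across such agreements.\<close>

lemma has_dir_deriv_cong:
  assumes A: "smooth_atlas A" and F: "has_dir_deriv A F x D" and V: "open V" "x \<in> V"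
    and eq: "\<And>z. z \<in> V \<Longrightarrow> F z = G z"
  shows "has_dir_deriv A G x D"
proof -
  let ?c = "chart_at A x"
  let ?S = "snd ?c ` (fst ?c \<inter> V)"
  have "open ?S" using open_chart_image[OF A chart_at_mem(1)[OF A] V(1)] .
  moreover have "snd ?c x \<in> ?S" using chart_at_mem(2)[OF A] V(2) by blast
  moreover have "(F \<circ> chart_inv ?c) p = (G \<circ> chart_inv ?c) p" if "p \<in> ?S" for p
    using that eq chart_inv_chart[OF A chart_at_mem(1)[OF A]] by auto
  ultimately show ?thesis
    using F unfolding has_dir_deriv_def by (rule has_derivative_transform_within_open[rotated])
qed

lemma chart_inv_base:
  assumes "smooth_atlas A"
  shows "chart_inv (chart_at A x) (snd (chart_at A x) x) = x"
  using chart_inv_chart[OF assms] chart_at_mem[OF assms] by blast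

lemma has_dir_deriv_smooth_fun:
  assumes A: "smooth_atlas A" and F: "smooth_fun A V F" and x: "x \<in> V"
  shows "has_dir_deriv A F x (dir_deriv A F x)"
proof (rule has_dir_deriv_differentiable)
  let ?c = "chart_at A x"
  have "smooth_on (snd ?c ` (fst ?c \<inter> V)) (F \<circ> chart_inv ?c)"
    using F chart_at_mem(1)[OF A] unfolding smooth_fun_def by blast
  then show "(F \<circ> chart_inv ?c) differentiable at (snd ?c x)"
    using chart_at_mem(2)[OF A] x by (intro differentiable_smooth_on) auto
qed

lemma has_dir_deriv_smooth_field:
  assumes A: "smooth_atlas A" and B: "smooth_atlas B" and Z: "smooth_field_along B A f V Z"
    and y: "y \<in> V"
  defines "F \<equiv> \<lambda>z. to_chart A (chart_at A (f y)) (f z) (Z z)"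
  shows "has_dir_deriv B F y (dir_deriv B F y)"
proof (rule has_dir_deriv_differentiable)
  let ?b = "chart_at B y" and ?c = "chart_at A (f y)"
  have "smooth_on (snd ?b ` (fst ?b \<inter> V \<inter> f -` fst ?c)) (F \<circ> chart_inv ?b)"
    using Z chart_at_mem(1)[OF A] chart_at_mem(1)[OF B] unfolding smooth_field_along_def F_def by blast
  then show "(F \<circ> chart_inv ?b) differentiable at (snd ?b y)"
    using chart_at_mem(2)[OF A] chart_at_mem(2)[OF B] y
    by (intro differentiable_smooth_on) auto
qed

lemma has_dir_deriv_differential:
  assumes A: "smooth_atlas A" and B: "smooth_atlas B" and f: "smooth_map B A f"
  shows "has_dir_deriv B (snd (chart_at A (f y)) \<circ> f) y (differential B A f y)"
  unfolding differential_def
proof (rule has_dir_deriv_differentiable)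
  let ?b = "chart_at B y" and ?c = "chart_at A (f y)"
  have "smooth_on (snd ?b ` (fst ?b \<inter> f -` fst ?c)) (snd ?c \<circ> f \<circ> chart_inv ?b)"
    using f chart_at_mem(1)[OF A] chart_at_mem(1)[OF B] unfolding smooth_map_def by blast
  then show "(snd ?c \<circ> f \<circ> chart_inv ?b) differentiable at (snd ?b y)"
    using chart_at_mem(2)[OF A] chart_at_mem(2)[OF B]
    by (intro differentiable_smooth_on) auto
qed

lemma open_vimage_chart:
  assumes "smooth_atlas A" "c \<in> A" "smooth_map B A f"
  shows "open (f -` fst c)"
  using assms unfolding smooth_atlas_def smooth_map_def
  by (metis open_vimage)

lemma has_dir_deriv_compose:
  assumes A: "smooth_atlas A" and B: "smooth_atlas B" and f: "smooth_map B A f"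
    and F: "has_dir_deriv A F (f y) D"
  shows "has_dir_deriv B (\<lambda>z. F (f z)) y (\<lambda>u. D (differential B A f y u))"
proof -
  let ?b = "chart_at B y" and ?c = "chart_at A (f y)"
  have 1: "(snd ?c \<circ> f \<circ> chart_inv ?b has_derivative differential B A f y) (at (snd ?b y))"
    using has_dir_deriv_differential[OF A B f, of y] unfolding has_dir_deriv_def by (simp add: comp_assoc)
  have "((F \<circ> chart_inv ?c) \<circ> (snd ?c \<circ> f \<circ> chart_inv ?b) has_derivative
      (D \<circ> differential B A f y)) (at (snd ?b y))"
    by (rule diff_chain_at[OF 1]) (use F in \<open>simp add: has_dir_deriv_def chart_inv_base[OF B]\<close>)
  then have "has_dir_deriv B (\<lambda>z. F (chart_inv ?c (snd ?c (f z)))) y (\<lambda>u. D (differential B A f y u))"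
    unfolding has_dir_deriv_def by (simp add: comp_def)
  \<comment> \<open>Inserting \<open>chart_inv ?c\<close> after \<open>snd ?c\<close> changes
    nothing as long as \<open>f\<close> stays in the chart domain, which holds on an open
    neighbourhood of \<open>y\<close>.\<close>
  then show ?thesis
    by (rule has_dir_deriv_cong[OF B _ open_vimage_chart[OF A chart_at_mem(1)[OF A] f]])
      (use chart_at_mem[OF A] chart_inv_chart[OF A] in auto)
qed

section \<open>The identity map and changes of coordinates\<close>

lemma smooth_map_id:
  assumes "smooth_atlas A" shows "smooth_map A A (\<lambda>x. x)"
proof -
  have "(snd c \<circ> (\<lambda>x. x)) \<circ> chart_inv b = snd c \<circ> chart_inv b" for b c :: "('a, 'b) chart" by auto
  then show ?thesis using assms unfolding smooth_map_def smooth_atlas_def by auto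
qed

lemma chart_self_derivative:
  assumes A: "smooth_atlas A" and c: "c \<in> A" and x: "x \<in> fst c"
  shows "(snd c \<circ> chart_inv c has_derivative (\<lambda>v. v)) (at (snd c x))"
proof (rule has_derivative_transform_within_open[OF has_derivative_ident])
  show "open (snd c ` fst c)" using A c unfolding smooth_atlas_def by blast
qed (use chart_inv_chart[OF A c] x in auto)

lemma coord_change_self:
  assumes "smooth_atlas A" "c \<in> A" "x \<in> fst c"
  shows "coord_change c c x = (\<lambda>v. v)"
  unfolding coord_change_def using frechet_derivative_at[OF chart_self_derivative[OF assms]] by simp

lemma differential_id:
  assumes "smooth_atlas A" shows "differential A A (\<lambda>x. x) x = (\<lambda>v. v)"
proof -
  have "has_dir_deriv A (snd (chart_at A x) \<circ> (\<lambda>x. x)) x (\<lambda>v. v)"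
    using chart_self_derivative[OF assms chart_at_mem[OF assms]] unfolding has_dir_deriv_def
    by (simp add: comp_def)
  from has_dir_deriv_eq[OF this] show ?thesis by (simp add: differential_def)
qed

text \<open>The preferred chart at \<open>x\<close> is compared with itself here, so the coordinate
  change is the identity. At nearby points another chart may be preferred, which is why
  \<open>to_chart\<close> stays inside all derivatives.\<close>

lemma
  assumes "smooth_atlas A"
  shows to_chart_base: "to_chart A (chart_at A x) x = (\<lambda>v. v)"
    and from_chart_base: "from_chart A (chart_at A x) x = (\<lambda>v. v)"
  unfolding to_chart_def from_chart_def
  using coord_change_self[OF assms chart_at_mem[OF assms]] by auto

lemma coord_change_derivative:
  assumes A: "smooth_atlas A" and c: "c \<in> A" "x \<in> fst c" and d: "d \<in> A" "x \<in> fst d"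
  shows "(snd d \<circ> chart_inv c has_derivative coord_change c d x) (at (snd c x))"
proof -
  have "smooth_on (snd c ` (fst c \<inter> fst d)) (snd d \<circ> chart_inv c)"
    using A c d unfolding smooth_atlas_def by blast
  then show ?thesis unfolding coord_change_def
    using c d differentiable_smooth_on frechet_derivative_works by blast
qed

text \<open>The two opposite transition maps compose to the identity near \<open>snd d x\<close>;
  the chain rule and uniqueness of derivatives do the rest.\<close>

lemma coord_change_inverse:
  assumes A: "smooth_atlas A" and c: "c \<in> A" "x \<in> fst c" and d: "d \<in> A" "x \<in> fst d"
  shows "coord_change c d x (coord_change d c x v) = v"
proof -
  have eq: "chart_inv d (snd d x) = x" using chart_inv_chart[OF A d] .
  have "((snd d \<circ> chart_inv c) \<circ> (snd c \<circ> chart_inv d) has_derivative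
     coord_change c d x \<circ> coord_change d c x) (at (snd d x))"
    using coord_change_derivative[OF A c d] coord_change_derivative[OF A d c] eq
    by (intro diff_chain_at) auto
  moreover have "((snd d \<circ> chart_inv c) \<circ> (snd c \<circ> chart_inv d) has_derivative (\<lambda>v. v)) (at (snd d x))"
  proof (rule has_derivative_transform_within_open[OF has_derivative_ident])
    show "open (snd d ` (fst d \<inter> fst c))"
      using A c d open_chart_image[OF A d(1), of "fst c"] unfolding smooth_atlas_def by blast
  qed (use chart_inv_chart[OF A c(1)] chart_inv_chart[OF A d(1)] c d in auto)
  ultimately have "coord_change c d x \<circ> coord_change d c x = (\<lambda>v. v)"
    by (rule has_derivative_unique)
  then show ?thesis by (metis comp_apply)
qed

lemma from_chart_to_chart:
  assumes "smooth_atlas A" "c \<in> A" "x \<in> fst c"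
  shows "from_chart A c x (to_chart A c x v) = v"
  unfolding from_chart_def to_chart_def
  using coord_change_inverse[OF assms(1) assms(2,3) chart_at_mem[OF assms(1)]] by simp

lemma linear_from_chart:
  assumes "smooth_atlas A" "c \<in> A" "x \<in> fst c" shows "linear (from_chart A c x)"
  unfolding from_chart_def using assms chart_at_mem[OF assms(1)] by (intro linear_coord_change) auto

section \<open>Bilinear forms and metrics in coordinates\<close>

lemma bilinear_expand:
  fixes b :: "real ^ 'm::finite \<Rightarrow> real ^ 'm \<Rightarrow> real"
  assumes "bilinear b"
  shows "b v w = (\<Sum>i\<in>UNIV. \<Sum>j\<in>UNIV. b (axis i 1) (axis j 1) * v $ i * w $ j)"
proof -
  have "b v w = b (\<Sum>i\<in>UNIV. v $ i *\<^sub>R axis i 1) (\<Sum>j\<in>UNIV. w $ j *\<^sub>R axis j 1)"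
    using basis_expansion[of v] basis_expansion[of w] by (simp add: scalar_mult_eq_scaleR)
  also have "\<dots> = (\<Sum>(i, j)\<in>UNIV \<times> UNIV. b (v $ i *\<^sub>R axis i 1) (w $ j *\<^sub>R axis j 1))"
    by (rule bilinear_sum[OF assms])
  also have "\<dots> = (\<Sum>i\<in>UNIV. \<Sum>j\<in>UNIV. b (v $ i *\<^sub>R axis i 1) (w $ j *\<^sub>R axis j 1))"
    by (simp only: sum.cartesian_product)
  finally show ?thesis
    by (simp add: bilinear_lmul[OF assms] bilinear_rmul[OF assms] ac_simps)
qed

text \<open>Throughout the domain of one fixed chart the metric is written with differentiable
  coefficients. This is what allows \<open>g(Z,Z)\<close> to be differentiated later.\<close>

lemma metric_in_chart:
  assumes A: "smooth_atlas A" and g: "bilinear (g z)" and c: "c \<in> A" "z \<in> fst c"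
  shows "g z v w = (\<Sum>i\<in>UNIV. \<Sum>j\<in>UNIV.
    metric_coeff A g c z $ i $ j * to_chart A c z v $ i * to_chart A c z w $ j)"
proof -
  let ?b = "\<lambda>v w. g z (from_chart A c z v) (from_chart A c z w)"
  have lin: "linear (from_chart A c z)" by (rule linear_from_chart[OF A c])
  have "bilinear ?b"
    using g lin unfolding bilinear_def by (auto intro: linear_compose[unfolded comp_def])
  from bilinear_expand[OF this, of "to_chart A c z v" "to_chart A c z w"] show ?thesis
    by (simp add: from_chart_to_chart[OF A c] metric_coeff_def)
qed

section \<open>Conformal change of the Levi-Civita connection\<close>

definition orthonormal_wrt ::
  "('m::finite \<Rightarrow> real) \<Rightarrow> (real ^ 'm \<Rightarrow> real ^ 'm \<Rightarrow> real) \<Rightarrow> ('m \<Rightarrow> real ^ 'm) \<Rightarrow> bool" where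
  "orthonormal_wrt \<epsilon> b e \<longleftrightarrow>
     (\<forall>i. \<epsilon> i = 1 \<or> \<epsilon> i = -1) \<and> (\<forall>i j. b (e i) (e j) = (if i = j then \<epsilon> i else 0))"

text \<open>Pairing with \<open>e j\<close> recovers the \<open>j\<close>-th coefficient of a
  combination of the \<open>e i\<close>, so the combination map \<open>T\<close> is injective. The
  basis is indexed by the coordinates themselves, so \<open>T\<close> is a linear endomorphism and
  hence surjective.\<close>

lemma orthonormal_expansion:
  assumes b: "bilinear b" and e: "orthonormal_wrt \<epsilon> b e"
  shows "v = (\<Sum>i\<in>UNIV. (\<epsilon> i * b v (e i)) *\<^sub>R e i)"
proof -
  define T where "T = (\<lambda>a::real^'a. \<Sum>i\<in>UNIV. a $ i *\<^sub>R e i)"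
  have lin: "linear T"
    unfolding T_def by (auto simp: linear_iff scaleR_left_distrib sum.distrib scaleR_sum_right)
  have comp: "\<epsilon> j * b (T a) (e j) = a $ j" for a j
  proof -
    have l: "linear (\<lambda>x. b x (e j))" using b by (simp add: bilinear_def)
    have "b (T a) (e j) = (\<Sum>i\<in>UNIV. a $ i * b (e i) (e j))"
      unfolding T_def by (simp add: linear_sum[OF l] linear_scale[OF l])
    also have "\<dots> = a $ j * \<epsilon> j"
      using e by (simp add: orthonormal_wrt_def if_distrib[of "\<lambda>x. _ * x"] cong: if_cong)
    finally show ?thesis using e by (metis (no_types) orthonormal_wrt_def mult.commute mult.left_commute mult_minus1_right mult_1_right minus_minus mult_minus_left)
  qed
  have "inj T" by (metis comp injI vec_eq_iff)
  then have "surj T" using lin by (simp add: linear_injective_imp_surjective)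
  then obtain a where "v = T a" by blast
  then show ?thesis using comp by (simp add: T_def)
qed

lemma semi_riemannian_orthonormal:
  assumes "semi_riemannian_metric A \<epsilon> g"
  obtains e where "orthonormal_wrt \<epsilon> (g x) e"
  using assms unfolding semi_riemannian_metric_def orthonormal_wrt_def by meson

lemma
  assumes "semi_riemannian_metric A \<epsilon> g"
  shows semi_riemannian_bilinear: "bilinear (g x)"
    and semi_riemannian_sym: "g x v w = g x w v"
  using assms unfolding semi_riemannian_metric_def by auto

lemma semi_riemannian_nondegenerate:
  assumes "semi_riemannian_metric A \<epsilon> g" "\<And>v. g x v w = 0"
  shows "w = 0"
proof -
  obtain e where e: "orthonormal_wrt \<epsilon> (g x) e" using semi_riemannian_orthonormal[OF assms(1)] .
  have "g x w (e i) = 0" for i using assms semi_riemannian_sym[OF assms(1)] by metis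
  then show ?thesis
    using orthonormal_expansion[OF semi_riemannian_bilinear[OF assms(1)] e, of w] by simp
qed

lemma metric_coeff_base:
  assumes "smooth_atlas A"
  shows "metric_coeff A g (chart_at A x) x $ i $ j = g x (axis i 1) (axis j 1)"
  by (simp add: metric_coeff_def from_chart_base[OF assms])

lemma metric_base:
  assumes A: "smooth_atlas A" and g: "semi_riemannian_metric A \<epsilon> g"
  shows "g x v w = v \<bullet> (metric_coeff A g (chart_at A x) x *v w)"
  unfolding bilinear_expand[OF semi_riemannian_bilinear[OF g], of x v w]
  by (simp add: inner_vec_def matrix_vector_mult_def metric_coeff_base[OF A] sum_distrib_left ac_simps)

text \<open>A vector in the kernel of the Gram matrix is orthogonal to everything, hence zero by
  nondegeneracy.\<close>

lemma metric_coeff_invertible: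
  assumes A: "smooth_atlas A" and g: "semi_riemannian_metric A \<epsilon> g"
  shows "invertible (metric_coeff A g (chart_at A x) x)"
proof -
  have "w = 0" if "metric_coeff A g (chart_at A x) x *v w = 0" for w
  proof (rule semi_riemannian_nondegenerate[OF g])
    show "g x v w = 0" for v by (simp add: metric_base[OF A g] that)
  qed
  then show ?thesis
    by (simp add: invertible_left_inverse matrix_left_invertible_ker)
qed

lemma
  fixes M :: "'a::semiring_1 ^ 'n ^ 'n"
  assumes "invertible M"
  shows matrix_inv_right: "M ** matrix_inv M = mat 1"
    and matrix_inv_left: "matrix_inv M ** M = mat 1"
  using someI_ex[OF assms[unfolded invertible_def]] unfolding matrix_inv_def by auto

text \<open>The index of the differential of \<sigma> is raised in the preferred chart at
  \<open>x\<close>, so the result is already in the encoding of tangent vectors at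
  \<open>x\<close>.\<close>

definition grad ::
  "('x, 'm::finite) chart set \<Rightarrow> ('x, 'm) metric \<Rightarrow> ('x \<Rightarrow> real) \<Rightarrow> 'x \<Rightarrow> real ^ 'm" where
  "grad A g \<sigma> x =
     matrix_inv (metric_coeff A g (chart_at A x) x) *v (\<chi> l. dir_deriv A \<sigma> x (axis l 1))"

lemma linear_axis_expansion:
  fixes D :: "real ^ 'm::finite \<Rightarrow> 'b::real_vector"
  assumes "linear D"
  shows "D v = (\<Sum>i\<in>UNIV. v $ i *\<^sub>R D (axis i 1))"
proof -
  have "D v = D (\<Sum>i\<in>UNIV. v $ i *\<^sub>R axis i 1)"
    using basis_expansion[of v] by (simp add: scalar_mult_eq_scaleR)
  then show ?thesis using assms by (simp add: linear_sum linear_scale)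
qed

lemma metric_grad:
  assumes A: "smooth_atlas A" and g: "semi_riemannian_metric A \<epsilon> g"
    and s: "smooth_fun A UNIV \<sigma>"
  shows "g x w (grad A g \<sigma> x) = dir_deriv A \<sigma> x w"
proof -
  let ?G = "metric_coeff A g (chart_at A x) x"
  have "?G *v grad A g \<sigma> x = (?G ** matrix_inv ?G) *v (\<chi> l. dir_deriv A \<sigma> x (axis l 1))"
    unfolding grad_def by (simp only: matrix_vector_mul_assoc)
  then have "?G *v grad A g \<sigma> x = (\<chi> l. dir_deriv A \<sigma> x (axis l 1))"
    using matrix_inv_right[OF metric_coeff_invertible[OF A g]] by simp
  then have "g x w (grad A g \<sigma> x) = (\<Sum>l\<in>UNIV. w $ l *\<^sub>R dir_deriv A \<sigma> x (axis l 1))"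
    using metric_base[OF A g] by (simp add: inner_vec_def)
  then show ?thesis
    using linear_axis_expansion[OF has_dir_deriv_linear[OF has_dir_deriv_smooth_fun[OF A s UNIV_I]]]
    by metis
qed

section \<open>Christoffel symbols under a conformal change\<close>

lemma metric_coeff_scale:
  "metric_coeff A (\<lambda>x v w. f x * g x v w) c x = f x *\<^sub>R metric_coeff A g c x"
  by (simp add: metric_coeff_def vec_eq_iff)

lemma matrix_inv_scaleR:
  fixes G :: "real ^ 'm ^ 'm::finite"
  assumes "invertible G" "a \<noteq> 0"
  shows "matrix_inv (a *\<^sub>R G) = inverse a *\<^sub>R matrix_inv G"
proof -
  have inv: "invertible (a *\<^sub>R G)" using assms by (simp add: scalar_invertible)
  \<comment> \<open>\<open>matrix_inv\<close> is defined by choice; multiplying by the product of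
    \<open>a *\<^sub>R G\<close> with the candidate inverse, which is the unit matrix, pins down its
    value.\<close>
  have "matrix_inv (a *\<^sub>R G) = matrix_inv (a *\<^sub>R G) ** ((a *\<^sub>R G) ** (inverse a *\<^sub>R matrix_inv G))"
    using matrix_inv_right[OF assms(1)] assms(2)
    by (simp add: matrix_scalar_ac scalar_matrix_assoc[symmetric])
  then show ?thesis
    using matrix_inv_left[OF inv] by (simp add: matrix_mul_assoc)
qed

lemma has_dir_deriv_metric_coeff:
  assumes A: "smooth_atlas A" and g: "semi_riemannian_metric A \<epsilon> g"
  shows "has_dir_deriv A (metric_coeff A g (chart_at A x)) x
    (dir_deriv A (metric_coeff A g (chart_at A x)) x)"
  by (rule has_dir_deriv_smooth_fun[OF A _ chart_at_mem(2)[OF A]])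
    (use g chart_at_mem[OF A] in \<open>auto simp: semi_riemannian_metric_def\<close>)

text \<open>In the preferred chart at \<open>x\<close> the coordinate derivatives of the metric are
  values of \<open>dir_deriv\<close>, to which the product rule for the conformal factor
  applies.\<close>

lemma christoffel_base:
  "christoffel A g (chart_at A x) x k i j =
     (let c = chart_at A x; dG = (\<lambda>a. dir_deriv A (metric_coeff A g c) x (axis a 1)) in
      1/2 * (\<Sum>l\<in>UNIV. matrix_inv (metric_coeff A g c x) $ k $ l *
            (dG i $ j $ l + dG j $ i $ l - dG l $ i $ j)))"
  by (simp add: christoffel_def dir_deriv_def Let_def)

lemma has_dir_deriv_exp_scaleR:
  fixes \<sigma> :: "'x::topological_space \<Rightarrow> real"
  assumes "smooth_atlas A" "has_dir_deriv A \<sigma> x d" "has_dir_deriv A F x D"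
  shows "has_dir_deriv A (\<lambda>z. exp (a * \<sigma> z) *\<^sub>R F z) x
    (\<lambda>v. exp (a * \<sigma> x) *\<^sub>R (D v + (a * d v) *\<^sub>R F x))"
  using assms(2,3) chart_inv_base[OF assms(1)] unfolding has_dir_deriv_def comp_def
  by (auto intro!: derivative_eq_intros simp: algebra_simps)

text \<open>Differentiating the factor \<open>exp (2 * \<sigma>)\<close> adds
  \<open>2 d\<sigma>\<close> times the metric to each derivative; the factor itself cancels against
  the inverse metric, and the 2 against the 1/2. Contracting the inverse metric with the metric
  gives the Kronecker deltas, and with the differential of \<sigma> the gradient.\<close>

lemma christoffel_conformal:
  fixes x :: "'x::topological_space"
  assumes A: "smooth_atlas A" and g: "semi_riemannian_metric A \<epsilon> g"
    and s: "smooth_fun A UNIV \<sigma>"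
  defines "c \<equiv> chart_at A x" and "d \<equiv> \<lambda>i. dir_deriv A \<sigma> x (axis i 1)"
  shows "christoffel A (\<lambda>x v w. exp (2 * \<sigma> x) * g x v w) c x k i j =
    christoffel A g c x k i j + (if k = j then d i else 0) + (if k = i then d j else 0)
    - metric_coeff A g c x $ i $ j * grad A g \<sigma> x $ k"
proof -
  let ?G = "metric_coeff A g c" and ?H = "metric_coeff A (\<lambda>x v w. exp (2 * \<sigma> x) * g x v w) c"
  let ?E = "exp (2 * \<sigma> x)"
  have H: "?H = (\<lambda>x. exp (2 * \<sigma> x) *\<^sub>R ?G x)" by (simp add: fun_eq_iff metric_coeff_scale)
  have dH: "dir_deriv A ?H x v = ?E *\<^sub>R (dir_deriv A ?G x v + (2 * dir_deriv A \<sigma> x v) *\<^sub>R ?G x)" for v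
    unfolding H using has_dir_deriv_exp_scaleR[OF A has_dir_deriv_smooth_fun[OF A s UNIV_I]
        has_dir_deriv_metric_coeff[OF A g], of 2, THEN has_dir_deriv_eq]
    by (simp add: c_def)
  have inv: "invertible (?G x)" using metric_coeff_invertible[OF A g] by (simp add: c_def)
  have I: "matrix_inv (?H x) = exp (- (2 * \<sigma> x)) *\<^sub>R matrix_inv (?G x)"
    unfolding H by (simp add: matrix_inv_scaleR[OF inv] exp_minus)
  have sym: "?G x $ i $ j = ?G x $ j $ i" for i j
    using semi_riemannian_sym[OF g] by (simp add: metric_coeff_def)
  have GI: "(\<Sum>l\<in>UNIV. matrix_inv (?G x) $ k $ l * ?G x $ j $ l) = (if k = j then 1 else 0)" for j
  proof -
    have "(matrix_inv (?G x) ** ?G x) $ k $ j = (if k = j then 1 else 0)"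
      using matrix_inv_left[OF inv] by (simp add: mat_def)
    then show ?thesis by (simp add: matrix_matrix_mult_def sym)
  qed
  have e: "exp (- (2 * \<sigma> x)) * p * (?E * (a + 2 * q * r) + ?E * (b + 2 * s * t) - ?E * (c + 2 * u * w))
      = p * ((a + b - c) + 2 * (q * r + s * t - u * w))" for p q r s t u w a b c :: real
  proof -
    have "exp (- (2 * \<sigma> x)) * ?E = 1" by (simp add: exp_minus)
    then show ?thesis by algebra
  qed
  have half: "1/2 * (p * (a + 2 * (q * r + s * t - u * w))) = 1/2 * (p * a) +
      (q * (p * r) + s * (p * t) - w * (p * u))" for p a q r s t u w :: real
    by (simp add: field_simps)
  have "christoffel A (\<lambda>x v w. exp (2 * \<sigma> x) * g x v w) c x k i j =
    1/2 * (\<Sum>l\<in>UNIV. matrix_inv (?G x) $ k $ l *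
      ((dir_deriv A ?G x (axis i 1) $ j $ l + dir_deriv A ?G x (axis j 1) $ i $ l
         - dir_deriv A ?G x (axis l 1) $ i $ j)
       + 2 * (d i * ?G x $ j $ l + d j * ?G x $ i $ l - d l * ?G x $ i $ j)))"
    unfolding christoffel_base[where A=A and x=x, folded c_def] Let_def dH I d_def
      vector_scaleR_component vector_add_component real_scaleR_def
    by (intro arg_cong[of _ _ "(*) (1/2)"] sum.cong refl) (rule e)
  also have "\<dots> = christoffel A g c x k i j +
     (d i * (\<Sum>l\<in>UNIV. matrix_inv (?G x) $ k $ l * ?G x $ j $ l)
      + d j * (\<Sum>l\<in>UNIV. matrix_inv (?G x) $ k $ l * ?G x $ i $ l)
      - ?G x $ i $ j * (\<Sum>l\<in>UNIV. matrix_inv (?G x) $ k $ l * d l))"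
    unfolding christoffel_base[where A=A and x=x, folded c_def] Let_def
    unfolding sum_distrib_left sum.distrib[symmetric] sum_subtractf[symmetric]
    by (intro sum.cong refl) (rule half)
  also have "(\<Sum>l\<in>UNIV. matrix_inv (?G x) $ k $ l * d l) = grad A g \<sigma> x $ k"
    by (simp add: grad_def matrix_vector_mult_def c_def d_def)
  finally show ?thesis unfolding GI by simp
qed

section \<open>Covariant derivatives along maps\<close>

lemma cov_along_cong:
  assumes B: "smooth_atlas B"
    and Z: "has_dir_deriv B (\<lambda>z. to_chart A (chart_at A (f y)) (f z) (Z z)) y D"
    and V: "open V" "y \<in> V" and eq: "\<And>z. z \<in> V \<Longrightarrow> Z z = Z' z"
  shows "cov_along B A g f Z' y u = cov_along B A g f Z y u"
proof -
  have "has_dir_deriv B (\<lambda>z. to_chart A (chart_at A (f y)) (f z) (Z' z)) y D"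
    by (rule has_dir_deriv_cong[OF B Z V]) (simp add: eq)
  from has_dir_deriv_eq[OF this] show ?thesis
    using has_dir_deriv_eq[OF Z] eq[OF V(2)]
    by (simp add: cov_along_def Let_def)
qed

lemma cov_along_linear:
  assumes A: "smooth_atlas A" and B: "smooth_atlas B" and f: "smooth_map B A f"
    and Z: "has_dir_deriv B (\<lambda>z. to_chart A (chart_at A (f y)) (f z) (Z z)) y D"
  shows "linear (cov_along B A g f Z y)"
proof -
  have 1: "linear D" using has_dir_deriv_linear[OF Z] .
  have 2: "linear (differential B A f y)"
    using has_dir_deriv_linear[OF has_dir_deriv_differential[OF A B f]] .
  show ?thesis
    unfolding cov_along_def Let_def has_dir_deriv_eq[OF Z] linear_iff vec_eq_iff
    by (auto simp: linear_add[OF 1] linear_scale[OF 1] linear_add[OF 2] linear_scale[OF 2]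
        sum.distrib sum_distrib_left algebra_simps)
qed

text \<open>Linearity of \<open>to_chart\<close> is available at points of the chart domain, so the
  scalar factor is pulled out on the open preimage of that domain.\<close>

lemma has_dir_deriv_to_chart_scale:
  assumes A: "smooth_atlas A" and B: "smooth_atlas B" and f: "smooth_map B A f"
    and s: "smooth_fun A UNIV \<sigma>"
    and Z: "has_dir_deriv B (\<lambda>z. to_chart A (chart_at A (f y)) (f z) (Z z)) y D"
  shows "has_dir_deriv B (\<lambda>z. to_chart A (chart_at A (f y)) (f z) (exp (a * \<sigma> (f z)) *\<^sub>R Z z)) y
    (\<lambda>u. exp (a * \<sigma> (f y)) *\<^sub>R (D u + (a * dir_deriv A \<sigma> (f y) (differential B A f y u)) *\<^sub>R Z y))"
proof -
  let ?c = "chart_at A (f y)"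
  have "has_dir_deriv B (\<lambda>z. \<sigma> (f z)) y (\<lambda>u. dir_deriv A \<sigma> (f y) (differential B A f y u))"
    by (rule has_dir_deriv_compose[OF A B f has_dir_deriv_smooth_fun[OF A s UNIV_I]])
  from has_dir_deriv_exp_scaleR[OF B this Z, of a]
  show ?thesis
    unfolding to_chart_base[OF A]
  proof (rule has_dir_deriv_cong[OF B])
    show "open (f -` fst ?c)" using open_vimage_chart[OF A chart_at_mem(1)[OF A] f] .
    show "y \<in> f -` fst ?c" using chart_at_mem(2)[OF A] by simp
  qed (simp add: linear_scale[OF linear_to_chart[OF A chart_at_mem(1)[OF A]]])
qed

text \<open>Differentiating \<open>exp (- \<sigma>)\<close> produces
  \<open>- d\<sigma>(w) Z\<close>, which cancels the first correction term of the Christoffel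
  symbols; the other two remain. A general map \<open>f\<close> covers both later uses: the normal
  field along the hypersurface and frames on the manifold.\<close>

lemma cov_along_conformal:
  fixes u :: "real ^ 'n::finite" and y :: "'y::topological_space"
  assumes A: "smooth_atlas A" and B: "smooth_atlas B" and f: "smooth_map B A f"
    and g: "semi_riemannian_metric A \<epsilon> g" and s: "smooth_fun A UNIV \<sigma>"
    and Z: "has_dir_deriv B (\<lambda>z. to_chart A (chart_at A (f y)) (f z) (Z z)) y D"
  defines "w \<equiv> differential B A f y u"
  shows "cov_along B A (\<lambda>x v w. exp (2 * \<sigma> x) * g x v w) f (\<lambda>z. exp (- \<sigma> (f z)) *\<^sub>R Z z) y u =
    exp (- \<sigma> (f y)) *\<^sub>R (cov_along B A g f Z y u + dir_deriv A \<sigma> (f y) (Z y) *\<^sub>R w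
       - g (f y) w (Z y) *\<^sub>R grad A g \<sigma> (f y))"
proof -
  let ?x = "f y" and ?c = "chart_at A (f y)"
  let ?d = "\<lambda>i. dir_deriv A \<sigma> ?x (axis i 1)"
  have d: "dir_deriv A \<sigma> ?x v = (\<Sum>i\<in>UNIV. v $ i * ?d i)" for v
    using linear_axis_expansion[OF has_dir_deriv_linear[OF has_dir_deriv_smooth_fun[OF A s UNIV_I]]]
    by (metis (no_types, lifting) real_scaleR_def sum.cong)
  have D: "dir_deriv B (\<lambda>z. to_chart A ?c (f z) (exp (- \<sigma> (f z)) *\<^sub>R Z z)) y u =
     exp (- \<sigma> ?x) *\<^sub>R (D u - dir_deriv A \<sigma> ?x w *\<^sub>R Z y)"
    using has_dir_deriv_to_chart_scale[OF A B f s Z, of "-1", THEN has_dir_deriv_eq]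
    by (simp add: w_def)
  have "(\<Sum>i\<in>UNIV. \<Sum>j\<in>UNIV. christoffel A (\<lambda>x v w. exp (2 * \<sigma> x) * g x v w) ?c ?x k i j
        * w $ i * (exp (- \<sigma> ?x) *\<^sub>R Z y) $ j)
     = exp (- \<sigma> ?x) * ((\<Sum>i\<in>UNIV. \<Sum>j\<in>UNIV. christoffel A g ?c ?x k i j * w $ i * Z y $ j)
        + dir_deriv A \<sigma> ?x w * Z y $ k + dir_deriv A \<sigma> ?x (Z y) * w $ k
        - g ?x w (Z y) * grad A g \<sigma> ?x $ k)" for k
  proof -
    have 1: "(\<Sum>i\<in>UNIV. \<Sum>j\<in>UNIV. (if k = j then ?d i else 0) * w $ i * Z y $ j)
       = dir_deriv A \<sigma> ?x w * Z y $ k"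
      by (simp add: d[of w] sum_distrib_right if_distrib[of "\<lambda>x. x * _"] cong: if_cong)
        (simp add: ac_simps)
    have 2: "(\<Sum>i\<in>UNIV. \<Sum>j\<in>UNIV. (if k = i then ?d j else 0) * w $ i * Z y $ j)
       = dir_deriv A \<sigma> ?x (Z y) * w $ k"
      by (subst sum.swap)
        (simp add: d[of "Z y"] sum_distrib_right if_distrib[of "\<lambda>x. x * _"] cong: if_cong,
          simp add: ac_simps)
    have 3: "(\<Sum>i\<in>UNIV. \<Sum>j\<in>UNIV. metric_coeff A g ?c ?x $ i $ j * grad A g \<sigma> ?x $ k * w $ i * Z y $ j)
       = g ?x w (Z y) * grad A g \<sigma> ?x $ k"
      unfolding bilinear_expand[OF semi_riemannian_bilinear[OF g], of ?x w "Z y"] metric_coeff_base[OF A]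
        sum_distrib_right
      by (simp add: ac_simps)
    have "(\<Sum>i\<in>UNIV. \<Sum>j\<in>UNIV. christoffel A (\<lambda>x v w. exp (2 * \<sigma> x) * g x v w) ?c ?x k i j
        * w $ i * (exp (- \<sigma> ?x) *\<^sub>R Z y) $ j)
     = exp (- \<sigma> ?x) * ((\<Sum>i\<in>UNIV. \<Sum>j\<in>UNIV. christoffel A g ?c ?x k i j * w $ i * Z y $ j)
        + (\<Sum>i\<in>UNIV. \<Sum>j\<in>UNIV. (if k = j then ?d i else 0) * w $ i * Z y $ j)
        + (\<Sum>i\<in>UNIV. \<Sum>j\<in>UNIV. (if k = i then ?d j else 0) * w $ i * Z y $ j)
        - (\<Sum>i\<in>UNIV. \<Sum>j\<in>UNIV. metric_coeff A g ?c ?x $ i $ j * grad A g \<sigma> ?x $ k * w $ i * Z y $ j))"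
      unfolding christoffel_conformal[OF A g s] sum.distrib[symmetric] sum_subtractf[symmetric]
        sum_distrib_left
      by (intro sum.cong refl) (simp add: algebra_simps)
    then show ?thesis unfolding 1 2 3 .
  qed
  then show ?thesis
    unfolding cov_along_def Let_def D has_dir_deriv_eq[OF Z] w_def[symmetric]
    by (simp add: vec_eq_iff algebra_simps)
qed

section \<open>Mean curvature\<close>

lemma has_derivative_vec_nth2:
  fixes F :: "'a::real_normed_vector \<Rightarrow> real ^ 'm ^ 'n"
  assumes "(F has_derivative D) (at p)"
  shows "((\<lambda>x. F x $ i $ j) has_derivative (\<lambda>v. D v $ i $ j)) (at p)"
  using bounded_linear.has_derivative[OF bounded_linear_vec_nth
      bounded_linear.has_derivative[OF bounded_linear_vec_nth assms]] .

text \<open>This is metric compatibility on the diagonal. With \<open>z\<close> in two slots, the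
  last two terms of the Christoffel formula differ only by exchanging \<open>j\<close> and
  \<open>l\<close>, so they cancel and half the derivative of the metric along \<open>w\<close> is
  left.\<close>

lemma metric_christoffel:
  fixes x :: "'x::topological_space"
  assumes A: "smooth_atlas A" and g: "semi_riemannian_metric A \<epsilon> g"
  defines "c \<equiv> chart_at A x"
  shows "g x z (\<chi> k. \<Sum>i\<in>UNIV. \<Sum>j\<in>UNIV. christoffel A g c x k i j * w $ i * z $ j) =
    1/2 * (\<Sum>j\<in>UNIV. \<Sum>l\<in>UNIV. dir_deriv A (metric_coeff A g c) x w $ j $ l * z $ j * z $ l)"
proof -
  let ?G = "metric_coeff A g c x" and ?dG = "dir_deriv A (metric_coeff A g c) x"
  let ?d = "\<lambda>i j l. ?dG (axis i 1) $ j $ l"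
  define S where "S = (\<chi> l. \<Sum>i\<in>UNIV. \<Sum>j\<in>UNIV. (?d i j l + ?d j i l - ?d l i j) * w $ i * z $ j)"
  have "(\<Sum>i\<in>UNIV. \<Sum>j\<in>UNIV. christoffel A g c x k i j * w $ i * z $ j)
     = ((1/2) *\<^sub>R (matrix_inv ?G *v S)) $ k" for k
  proof -
    have "(\<Sum>i\<in>UNIV. \<Sum>j\<in>UNIV. christoffel A g c x k i j * w $ i * z $ j)
      = (\<Sum>i\<in>UNIV. \<Sum>j\<in>UNIV. \<Sum>l\<in>UNIV.
          1/2 * (matrix_inv ?G $ k $ l * ((?d i j l + ?d j i l - ?d l i j) * w $ i * z $ j)))"
      unfolding christoffel_base[where A=A and x=x, folded c_def] Let_def sum_distrib_left sum_distrib_right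
      by (simp add: ac_simps)
    also have "\<dots> = (\<Sum>l\<in>UNIV. \<Sum>i\<in>UNIV. \<Sum>j\<in>UNIV.
          1/2 * (matrix_inv ?G $ k $ l * ((?d i j l + ?d j i l - ?d l i j) * w $ i * z $ j)))"
      by (subst (2) sum.swap, subst sum.swap) simp
    finally show ?thesis
      by (simp add: matrix_vector_mult_def S_def sum_distrib_left)
  qed
  then have "(\<chi> k. \<Sum>i\<in>UNIV. \<Sum>j\<in>UNIV. christoffel A g c x k i j * w $ i * z $ j)
     = (1/2) *\<^sub>R (matrix_inv ?G *v S)" by (simp add: vec_eq_iff)
  moreover have "?G *v ((1/2) *\<^sub>R (matrix_inv ?G *v S)) = (1/2) *\<^sub>R S"
    using matrix_inv_right[OF metric_coeff_invertible[OF A g, of x]]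
    by (simp add: matrix_vector_mult_scaleR matrix_vector_mul_assoc c_def)
  ultimately have "g x z (\<chi> k. \<Sum>i\<in>UNIV. \<Sum>j\<in>UNIV. christoffel A g c x k i j * w $ i * z $ j)
     = z \<bullet> ((1/2) *\<^sub>R S)"
    by (simp add: metric_base[OF A g] c_def)
  also have "\<dots> = 1/2 * (\<Sum>l\<in>UNIV. \<Sum>i\<in>UNIV. \<Sum>j\<in>UNIV.
      (?d i j l + ?d j i l - ?d l i j) * w $ i * z $ j * z $ l)"
    by (simp add: inner_vec_def S_def sum_distrib_left ac_simps)
  also have "(\<Sum>l\<in>UNIV. \<Sum>i\<in>UNIV. \<Sum>j\<in>UNIV. (?d i j l + ?d j i l - ?d l i j) * w $ i * z $ j * z $ l)
      = (\<Sum>l\<in>UNIV. \<Sum>i\<in>UNIV. \<Sum>j\<in>UNIV. ?d i j l * w $ i * z $ j * z $ l)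
        + ((\<Sum>l\<in>UNIV. \<Sum>i\<in>UNIV. \<Sum>j\<in>UNIV. ?d j i l * w $ i * z $ j * z $ l)
          - (\<Sum>l\<in>UNIV. \<Sum>i\<in>UNIV. \<Sum>j\<in>UNIV. ?d l i j * w $ i * z $ j * z $ l))"
    unfolding sum.distrib[symmetric] sum_subtractf[symmetric]
    by (intro sum.cong refl) (simp add: algebra_simps)
  also have "(\<Sum>l\<in>UNIV. \<Sum>i\<in>UNIV. \<Sum>j\<in>UNIV. ?d j i l * w $ i * z $ j * z $ l)
      = (\<Sum>l\<in>UNIV. \<Sum>i\<in>UNIV. \<Sum>j\<in>UNIV. ?d l i j * w $ i * z $ j * z $ l)"
  proof -
    have "(\<Sum>l\<in>UNIV. \<Sum>i\<in>UNIV. \<Sum>j\<in>UNIV. ?d j i l * w $ i * z $ j * z $ l)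
      = (\<Sum>i\<in>UNIV. \<Sum>l\<in>UNIV. \<Sum>j\<in>UNIV. ?d j i l * w $ i * z $ j * z $ l)" by (rule sum.swap)
    also have "\<dots> = (\<Sum>i\<in>UNIV. \<Sum>j\<in>UNIV. \<Sum>l\<in>UNIV. ?d j i l * w $ i * z $ j * z $ l)"
      by (rule sum.cong[OF refl]) (rule sum.swap)
    also have "\<dots> = (\<Sum>j\<in>UNIV. \<Sum>i\<in>UNIV. \<Sum>l\<in>UNIV. ?d j i l * w $ i * z $ j * z $ l)"
      by (rule sum.swap)
    finally show ?thesis by (simp add: ac_simps)
  qed
  also have "(\<Sum>l\<in>UNIV. \<Sum>i\<in>UNIV. \<Sum>j\<in>UNIV. ?d i j l * w $ i * z $ j * z $ l)
     = (\<Sum>j\<in>UNIV. \<Sum>l\<in>UNIV. ?dG w $ j $ l * z $ j * z $ l)"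
  proof -
    have w: "?dG w $ j $ l = (\<Sum>i\<in>UNIV. w $ i * ?d i j l)" for j l
      using linear_axis_expansion[OF has_dir_deriv_linear[OF has_dir_deriv_metric_coeff[OF A g, of x]], of w]
      by (simp add: c_def)
    have "(\<Sum>l\<in>UNIV. \<Sum>i\<in>UNIV. \<Sum>j\<in>UNIV. ?d i j l * w $ i * z $ j * z $ l)
      = (\<Sum>l\<in>UNIV. \<Sum>j\<in>UNIV. \<Sum>i\<in>UNIV. ?d i j l * w $ i * z $ j * z $ l)"
      by (rule sum.cong[OF refl]) (rule sum.swap)
    also have "\<dots> = (\<Sum>j\<in>UNIV. \<Sum>l\<in>UNIV. \<Sum>i\<in>UNIV. ?d i j l * w $ i * z $ j * z $ l)"
      by (rule sum.swap)
    finally show ?thesis unfolding w sum_distrib_right by (simp add: ac_simps)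
  qed
  finally show ?thesis by simp
qed

text \<open>Differentiating \<open>g(Z,Z)\<^sup>2 = 1\<close> instead of \<open>g(Z,Z) = \<plusminus>1\<close> makes a connectedness argument for the
  sign superfluous.\<close>

lemma cov_along_unit_orthogonal:
  assumes A: "smooth_atlas A" and B: "smooth_atlas B" and f: "smooth_map B A f"
    and g: "semi_riemannian_metric A \<epsilon> g"
    and Z: "has_dir_deriv B (\<lambda>z. to_chart A (chart_at A (f y)) (f z) (Z z)) y D"
    and unit: "\<And>z. \<bar>g (f z) (Z z) (Z z)\<bar> = 1"
  shows "g (f y) (Z y) (cov_along B A g f Z y u) = 0"
proof -
  let ?x = "f y" and ?c = "chart_at A (f y)" and ?b = "chart_at B y"
  let ?G = "metric_coeff A g ?c" and ?p = "snd (chart_at B y) y"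
  let ?w = "differential B A f y"
  let ?dG = "dir_deriv A ?G ?x"
  define F where "F = (\<lambda>z. to_chart A ?c (f z) (Z z))"
  \<comment> \<open>\<open>Q\<close> is \<open>g(Z,Z)\<close> in the fixed chart at
    \<open>f y\<close>, with differentiable coefficients; it agrees with the metric as long as
    \<open>f\<close> stays in that chart.\<close>
  define Q where "Q = (\<lambda>z. \<Sum>i\<in>UNIV. \<Sum>j\<in>UNIV. ?G (f z) $ i $ j * F z $ i * F z $ j)"
  define dQ where "dQ = (\<lambda>u. \<Sum>i\<in>UNIV. \<Sum>j\<in>UNIV. ?dG (?w u) $ i $ j * Z y $ i * Z y $ j
     + ?G ?x $ i $ j * D u $ i * Z y $ j + ?G ?x $ i $ j * Z y $ i * D u $ j)"
  have Fy: "F y = Z y" by (simp add: F_def to_chart_base[OF A])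
  have invb: "chart_inv ?b ?p = y" by (rule chart_inv_base[OF B])
  have hF: "(F \<circ> chart_inv ?b has_derivative D) (at ?p)"
    using Z unfolding has_dir_deriv_def F_def .
  have hG: "((\<lambda>z. ?G (f z)) \<circ> chart_inv ?b has_derivative (\<lambda>u. ?dG (?w u))) (at ?p)"
    using has_dir_deriv_compose[OF A B f has_dir_deriv_metric_coeff[OF A g]] unfolding has_dir_deriv_def .
  have "((\<lambda>p. \<Sum>i\<in>UNIV. \<Sum>j\<in>UNIV. ((\<lambda>z. ?G (f z)) \<circ> chart_inv ?b) p $ i $ j
       * (F \<circ> chart_inv ?b) p $ i * (F \<circ> chart_inv ?b) p $ j) has_derivative dQ) (at ?p)"
    unfolding dQ_def
    by (rule derivative_eq_intros refl has_derivative_vec_nth2[OF hG]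
        bounded_linear.has_derivative[OF bounded_linear_vec_nth hF])+
      (simp add: invb Fy algebra_simps)
  then have hQ: "has_dir_deriv B Q y dQ"
    unfolding has_dir_deriv_def Q_def comp_def .
  have Q: "Q z = g (f z) (Z z) (Z z)" if "z \<in> f -` fst ?c" for z
    using that unfolding Q_def F_def
    by (subst metric_in_chart[OF A semi_riemannian_bilinear[OF g] chart_at_mem(1)[OF A]]) auto
  have Q2: "Q z * Q z = 1" if "z \<in> f -` fst ?c" for z
    using Q[OF that] unit[of z] by (metis abs_mult_self mult_1)
  have "has_dir_deriv B (\<lambda>z. Q z * Q z) y (\<lambda>u. Q y * dQ u + dQ u * Q y)"
    using hQ unfolding has_dir_deriv_def comp_def
    by (auto intro!: derivative_eq_intros simp: invb)
  moreover have "has_dir_deriv B (\<lambda>z. Q z * Q z) y (\<lambda>u. 0)"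
  proof (rule has_dir_deriv_cong[OF B])
    show "has_dir_deriv B (\<lambda>z. 1::real) y (\<lambda>u. 0)"
      unfolding has_dir_deriv_def comp_def by simp
    show "open (f -` fst ?c)" using open_vimage_chart[OF A chart_at_mem(1)[OF A] f] .
  qed (use Q2 chart_at_mem[OF A] in auto)
  ultimately have "Q y * dQ u + dQ u * Q y = 0"
    using has_dir_deriv_eq by (metis (no_types, lifting))
  moreover have "Q y \<noteq> 0" using Q2[of y] chart_at_mem[OF A] by auto
  ultimately have dQ0: "dQ u = 0" by simp
  have sym: "g ?x v w = g ?x w v" for v w by (rule semi_riemannian_sym[OF g])
  have b: "(\<Sum>i\<in>UNIV. \<Sum>j\<in>UNIV. ?G ?x $ i $ j * v $ i * w $ j) = g ?x v w" for v w
    unfolding metric_coeff_base[OF A]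
    by (rule bilinear_expand[OF semi_riemannian_bilinear[OF g], symmetric])
  \<comment> \<open>By \<open>metric_christoffel\<close>, this and the next equation combine to
    \<open>dQ u = 2 g(Z, \<nabla>\<^sub>uZ)\<close>.\<close>
  have "dQ u = (\<Sum>i\<in>UNIV. \<Sum>j\<in>UNIV. ?dG (?w u) $ i $ j * Z y $ i * Z y $ j)
      + 2 * g ?x (Z y) (D u)"
    unfolding dQ_def sum.distrib b using sym[of "D u" "Z y"] by simp
  moreover have "g ?x (Z y) (cov_along B A g f Z y u) = g ?x (Z y) (D u) +
      1/2 * (\<Sum>i\<in>UNIV. \<Sum>j\<in>UNIV. ?dG (?w u) $ i $ j * Z y $ i * Z y $ j)"
    unfolding cov_along_def Let_def has_dir_deriv_eq[OF Z]
    by (simp only: bilinear_radd[OF semi_riemannian_bilinear[OF g]] metric_christoffel[OF A g])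
  ultimately show ?thesis using dQ0 by simp
qed

text \<open>Since \<open>b N N\<close> is nonzero, \<open>N\<close> lies outside the range of
  \<open>L\<close>, and by dimension the two span the whole space. Pairing \<open>w\<close> with
  \<open>N\<close> then shows that its \<open>N\<close>-component vanishes.\<close>

lemma hyperplane_range:
  fixes L :: "real ^ 'n::finite \<Rightarrow> real ^ 'm::finite"
  assumes L: "linear L" "inj L" and card: "CARD('m) = CARD('n) + 1"
    and b: "bilinear b" and N: "b N N \<noteq> 0" "\<And>u. b N (L u) = 0" and w: "b N w = 0"
  shows "w \<in> range L"
proof -
  have sub: "subspace (range L)" using L by (simp add: linear_subspace_image)
  have "dim (range L) = CARD('n)" using dim_image_eq[of L UNIV] L by simp
  moreover have "N \<notin> span (range L)" using N sub by (auto simp: span_eq_iff[THEN iffD2])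
  ultimately have "dim (insert N (range L)) = DIM(real ^ 'm)" using card by (simp add: dim_insert)
  then have "span (insert N (range L)) = UNIV" by (simp only: dim_eq_full)
  then obtain k where "w - k *\<^sub>R N \<in> range L"
    using span_breakdown_eq[of w N "range L"] sub by (auto simp: span_eq_iff[THEN iffD2])
  then obtain u where u: "w = k *\<^sub>R N + L u" by (metis rangeE diff_add_cancel add.commute)
  then have "k = 0"
    using w N by (simp add: bilinear_radd[OF b] bilinear_rmul[OF b])
  then show ?thesis using u by simp
qed

section \<open>The hypersurface and its Weingarten map\<close>

lemma hypersurface_properties:
  fixes X :: "('x::topological_space, 'm::finite, 'q::topological_space, 'k::finite) spin_manifold"
    and M :: "('x, 'm, 'y::topological_space, 'n::finite) hypersurface"
    and y :: 'y
  assumes X: "spin_mfd X" and M: "hypersurface_in X M"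
  defines "L \<equiv> differential (hcharts M) (charts X) (emb M) y"
  shows "linear L" "inj L"
    and "metric X (emb M y) (normal M y) (L u) = 0"
    and "\<bar>metric X (emb M y) (normal M y) (normal M y)\<bar> = 1"
    and "has_dir_deriv (hcharts M)
       (\<lambda>z. to_chart (charts X) (chart_at (charts X) (emb M y)) (emb M z) (normal M z)) y
       (dir_deriv (hcharts M)
         (\<lambda>z. to_chart (charts X) (chart_at (charts X) (emb M y)) (emb M z) (normal M z)) y)"
  using X M has_dir_deriv_linear[OF has_dir_deriv_differential]
  by (auto simp: spin_mfd_def hypersurface_in_def unit_normal_def L_def intro: has_dir_deriv_smooth_field)

text \<open>The definition of \<open>weingarten\<close> applies \<open>inv\<close> to a map that is not surjective; its value is
  meaningful only because \<open>\<nabla>\<^sub>uN\<close> is orthogonal to \<open>N\<close>, hence tangent to the hypersurface.\<close>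

lemma differential_weingarten:
  fixes X :: "('x::topological_space, 'm::finite, 'q::topological_space, 'k::finite) spin_manifold"
    and M :: "('x, 'm, 'y::topological_space, 'n::finite) hypersurface"
  assumes X: "spin_mfd X" and M: "hypersurface_in X M"
  shows "differential (hcharts M) (charts X) (emb M) y (weingarten X M y u) =
    - cov_along (hcharts M) (charts X) (metric X) (emb M) (normal M) y u"
proof -
  let ?g = "metric X (emb M y)" and ?L = "differential (hcharts M) (charts X) (emb M) y"
  let ?C = "cov_along (hcharts M) (charts X) (metric X) (emb M) (normal M) y u"
  note h = hypersurface_properties[OF X M]
  have g: "semi_riemannian_metric (charts X) (signs X) (metric X)" and A: "smooth_atlas (charts X)"
    using X by (auto simp: spin_mfd_def)
  have B: "smooth_atlas (hcharts M)" and f: "smooth_map (hcharts M) (charts X) (emb M)"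
    and card: "CARD('m) = CARD('n) + 1" using M by (auto simp: hypersurface_in_def)
  have b: "bilinear ?g" by (rule semi_riemannian_bilinear[OF g])
  have "?g (normal M y) (- ?C) = 0"
    using cov_along_unit_orthogonal[OF A B f g h(5) h(4)] by (simp add: bilinear_rneg[OF b])
  then have "- ?C \<in> range ?L"
    using h(4)[of y] by (intro hyperplane_range[OF h(1,2) card b _ h(3)]) auto
  then show ?thesis unfolding weingarten_def by (rule f_inv_into_f)
qed

text \<open>For the normal field the gradient term of \<open>cov_along_conformal\<close> drops out,
  because \<open>N\<close> is orthogonal to tangent vectors. What remains is the image under the
  injective differential of the claimed vector, so \<open>inv\<close> returns that vector.\<close>

lemma weingarten_conformal:
  fixes X :: "('x::topological_space, 'm::finite, 'q::topological_space, 'k::finite) spin_manifold"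
    and M :: "('x, 'm, 'y::topological_space, 'n::finite) hypersurface"
  assumes X: "spin_mfd X" and M: "hypersurface_in X M" and s: "smooth_fun (charts X) UNIV \<sigma>"
  shows "weingarten (conformal \<sigma> X) (conformal_hyp \<sigma> M) y u = exp (- \<sigma> (emb M y)) *\<^sub>R
    (weingarten X M y u - dir_deriv (charts X) \<sigma> (emb M y) (normal M y) *\<^sub>R u)"
proof -
  let ?L = "differential (hcharts M) (charts X) (emb M) y"
  let ?ds = "dir_deriv (charts X) \<sigma> (emb M y) (normal M y)"
  note h = hypersurface_properties[OF X M]
  have g: "semi_riemannian_metric (charts X) (signs X) (metric X)" and A: "smooth_atlas (charts X)"
    using X by (auto simp: spin_mfd_def)
  have B: "smooth_atlas (hcharts M)" and f: "smooth_map (hcharts M) (charts X) (emb M)"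
    using M by (auto simp: hypersurface_in_def)
  have "- cov_along (hcharts M) (charts X) (\<lambda>x v w. exp (2 * \<sigma> x) * metric X x v w) (emb M)
      (\<lambda>z. exp (- \<sigma> (emb M z)) *\<^sub>R normal M z) y u
    = ?L (exp (- \<sigma> (emb M y)) *\<^sub>R (weingarten X M y u - ?ds *\<^sub>R u))"
    unfolding cov_along_conformal[OF A B f g s h(5)]
    using h(3)[of y u] semi_riemannian_sym[OF g, of _ "normal M y" "?L u"]
    by (simp add: linear_scale[OF h(1)] linear_diff[OF h(1)] differential_weingarten[OF X M]
        scaleR_diff_right scaleR_add_right)
  then show ?thesis
    unfolding weingarten_def[of "conformal \<sigma> X"]
    by (simp add: conformal_def conformal_hyp_def inv_f_f[OF h(2)])
qed

text \<open>The multiple of the identity in \<open>weingarten_conformal\<close> has trace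
  \<open>n\<close> times its factor, and the normalisation \<open>1/n\<close> removes the
  \<open>n\<close>.\<close>

lemma mean_curvature_conformal:
  fixes X :: "('x::topological_space, 'm::finite, 'q::topological_space, 'k::finite) spin_manifold"
    and M :: "('x, 'm, 'y::topological_space, 'n::finite) hypersurface"
  assumes X: "spin_mfd X" and M: "hypersurface_in X M" and s: "smooth_fun (charts X) UNIV \<sigma>"
  shows "mean_curvature (conformal \<sigma> X) (conformal_hyp \<sigma> M) y = exp (- \<sigma> (emb M y)) *
    (mean_curvature X M y - dir_deriv (charts X) \<sigma> (emb M y) (normal M y))"
proof -
  have "trace (matrix (weingarten (conformal \<sigma> X) (conformal_hyp \<sigma> M) y)) = exp (- \<sigma> (emb M y)) *
      (trace (matrix (weingarten X M y)) - real CARD('n) * dir_deriv (charts X) \<sigma> (emb M y) (normal M y))"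
    by (simp add: trace_def matrix_def weingarten_conformal[OF X M s] sum_subtractf sum_distrib_left[symmetric])
  then show ?thesis by (simp add: mean_curvature_def field_simps)
qed

section \<open>Sections of the spin structure and Clifford multiplication\<close>

lemma Ck_on_const: "Ck_on k S (\<lambda>x. c)"
  by (induction k arbitrary: c) auto

lemma smooth_on_const_scaleR:
  assumes "open S" "smooth_on S f" shows "smooth_on S (\<lambda>x. r *\<^sub>R f x)"
  using assms Ck_on_scaleR[OF assms(1) Ck_on_const] unfolding smooth_on_def by blast

lemma smooth_on_sum:
  assumes "open S" "finite I" "\<And>i. i \<in> I \<Longrightarrow> smooth_on S (f i)"
  shows "smooth_on S (\<lambda>x. \<Sum>i\<in>I. f i x)"
  using assms(2,3)
proof (induction I)
  case empty then show ?case by (simp add: smooth_on_def Ck_on_const)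
next
  case (insert i I)
  then show ?case by (simp add: smooth_on_def Ck_on_add[OF assms(1)])
qed

lemma open_section_domain:
  assumes A: "smooth_atlas A" and "b \<in> A" "c \<in> A" "open V"
  shows "open (snd b ` (fst b \<inter> V \<inter> (\<lambda>x. x) -` fst c))"
  using open_chart_image[OF A \<open>b \<in> A\<close>, of "V \<inter> fst c"] assms
  unfolding smooth_atlas_def by (simp add: Int_assoc open_Int)

lemma smooth_field_along_cong:
  assumes A: "smooth_atlas A" and V: "open V" and Z: "smooth_field_along A A (\<lambda>x. x) V Z"
    and eq: "\<And>z. z \<in> V \<Longrightarrow> Z z = Z' z"
  shows "smooth_field_along A A (\<lambda>x. x) V Z'"
  unfolding smooth_field_along_def
proof (intro ballI)
  fix b c assume b: "b \<in> A" and c: "c \<in> A"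
  show "smooth_on (snd b ` (fst b \<inter> V \<inter> (\<lambda>x. x) -` fst c)) ((\<lambda>y. to_chart A c y (Z' y)) \<circ> chart_inv b)"
    by (rule smooth_on_cong[OF open_section_domain[OF A b c V], THEN iffD1,
          of "(\<lambda>y. to_chart A c y (Z y)) \<circ> chart_inv b"])
      (use Z b c eq chart_inv_chart[OF A b] in \<open>auto simp: smooth_field_along_def\<close>)
qed

lemma smooth_field_along_sum:
  assumes A: "smooth_atlas A" and V: "open V" and I: "finite I"
    and Z: "\<And>i. i \<in> I \<Longrightarrow> smooth_field_along A A (\<lambda>x. x) V (Z i)"
  shows "smooth_field_along A A (\<lambda>x. x) V (\<lambda>z. \<Sum>i\<in>I. r i *\<^sub>R Z i z)"
  unfolding smooth_field_along_def
proof (intro ballI)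
  fix b c assume b: "b \<in> A" and c: "c \<in> A"
  let ?S = "snd b ` (fst b \<inter> V \<inter> (\<lambda>x. x) -` fst c)"
  have o: "open ?S" by (rule open_section_domain[OF A b c V])
  have "smooth_on ?S (\<lambda>p. \<Sum>i\<in>I. r i *\<^sub>R ((\<lambda>y. to_chart A c y (Z i y)) \<circ> chart_inv b) p)"
    using Z b c unfolding smooth_field_along_def
    by (intro smooth_on_sum[OF o I] smooth_on_const_scaleR[OF o]) blast
  then show "smooth_on ?S ((\<lambda>y. to_chart A c y (\<Sum>i\<in>I. r i *\<^sub>R Z i y)) \<circ> chart_inv b)"
    by (rule smooth_on_cong[OF o, THEN iffD1, rotated])
      (use chart_inv_chart[OF A b] in \<open>auto simp: linear_sum[OF linear_to_chart[OF A c]]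
        linear_scale[OF linear_to_chart[OF A c]]\<close>)
qed

lemma smooth_section_conformal_imp:
  assumes A: "smooth_atlas (charts X)" and s: "smooth_fun (charts X) UNIV \<sigma>"
    and t: "smooth_section X V t"
  shows "smooth_section (conformal \<sigma> X) V t"
proof -
  have V: "open V" and p: "\<And>z. z \<in> V \<Longrightarrow> proj X (t z) = z" using t by (auto simp: smooth_section_def)
  have "smooth_field_along (charts X) (charts X) (\<lambda>x. x) V
      (\<lambda>x. exp (- \<sigma> (proj X (t x))) *\<^sub>R frame X (t x) i)" for i
  proof (rule smooth_field_along_cong[OF A V])
    show "smooth_field_along (charts X) (charts X) (\<lambda>x. x) V (\<lambda>x. exp (-1 * \<sigma> x) *\<^sub>R frame X (t x) i)"
      using t by (intro smooth_field_scale[OF A s V]) (auto simp: smooth_section_def)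
  qed (simp add: p)
  then show ?thesis using t by (simp add: smooth_section_def conformal_def)
qed

text \<open>Undoing the change by \<open>- \<sigma>\<close> turns the one-way transfer of smooth
  sections into an equivalence.\<close>

lemma conformal_inverse: "conformal (\<lambda>x. - \<sigma> x) (conformal \<sigma> X) = X"
proof -
  have 1: "exp (- (2 * \<sigma> x)) * (exp (2 * \<sigma> x) * a) = a" for x a
    by (simp add: mult.assoc[symmetric] exp_add[symmetric])
  have 2: "exp (\<sigma> x) *\<^sub>R (exp (- \<sigma> x) *\<^sub>R v) = v" for x and v :: "real ^ 'b"
    by (simp add: exp_minus)
  show ?thesis by (simp add: conformal_def 1 2 del: scaleR_scaleR)
qed

lemma smooth_section_conformal:
  assumes A: "smooth_atlas (charts X)" and s: "smooth_fun (charts X) UNIV \<sigma>"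
  shows "smooth_section (conformal \<sigma> X) V t \<longleftrightarrow> smooth_section X V t"
proof
  assume "smooth_section (conformal \<sigma> X) V t"
  moreover have "smooth_fun (charts X) UNIV (\<lambda>x. - \<sigma> x)"
    unfolding smooth_fun_def
  proof
    fix c assume c: "c \<in> charts X"
    have "smooth_on (snd c ` (fst c \<inter> UNIV)) (\<lambda>p. (-1) *\<^sub>R (\<sigma> \<circ> chart_inv c) p)"
      using s c open_chart_image[OF A c open_UNIV]
      by (intro smooth_on_const_scaleR) (auto simp: smooth_fun_def comp_def)
    then show "smooth_on (snd c ` (fst c \<inter> UNIV)) ((\<lambda>x. - \<sigma> x) \<circ> chart_inv c)"
      by (simp add: comp_def)
  qed
  ultimately show "smooth_section X V t"
    using smooth_section_conformal_imp[of "conformal \<sigma> X" "\<lambda>x. - \<sigma> x"] A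
    by (simp add: conformal_inverse) (simp add: conformal_def)
qed (rule smooth_section_conformal_imp[OF A s])

text \<open>Both metrics have the same smooth sections, so the choice operator returns the same one.\<close>

lemma section_through_conformal:
  assumes "smooth_atlas (charts X)" "smooth_fun (charts X) UNIV \<sigma>"
  shows "section_through (conformal \<sigma> X) q = section_through X q"
  unfolding section_through_def smooth_section_conformal[OF assms] by (simp add: conformal_def)

text \<open>This justifies the choice in \<open>section_through\<close>. A local trivialisation by a
  section \<open>t\<close> writes \<open>q\<close> as a translate of a value of \<open>t\<close> by
  some \<open>u\<close> in the spin group; translating all of \<open>t\<close> by this constant
  \<open>u\<close> gives a smooth section through \<open>q\<close>.\<close>

lemma section_through:
  fixes X :: "('x::topological_space, 'm::finite, 'q::topological_space, 'k::finite) spin_manifold"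
  assumes X: "spin_mfd X"
  obtains V where "proj X q \<in> V" "smooth_section X V (section_through X q)"
    "section_through X q (proj X q) = q"
proof -
  have A: "smooth_atlas (charts X)" and P: "spin_structure X" using X by (auto simp: spin_mfd_def)
  obtain V t h where V: "proj X q \<in> V" and t: "smooth_section X V t"
    and h: "homeomorphism (V \<times> Spin X) (proj X -` V) (\<lambda>(z, u). act X (t z) u) h"
    using P unfolding spin_structure_def by meson
  have "q \<in> (\<lambda>(z, u). act X (t z) u) ` (V \<times> Spin X)"
    using V homeomorphism_image1[OF h] by auto
  then obtain z u where zu: "z \<in> V" "u \<in> Spin X" "q = act X (t z) u" by auto
  let ?s = "\<lambda>z. act X (t z) u"
  have pr: "proj X (?s z) = z" if "z \<in> V" for z
    using that t P zu(2) by (simp add: smooth_section_def spin_structure_def)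
  have "?s (proj X q) = q" using pr zu by metis
  moreover have "smooth_section X V ?s"
    unfolding smooth_section_def
  proof (intro conjI allI ballI)
    show V': "open V" using t by (simp add: smooth_section_def)
    have "continuous_on V (\<lambda>z. (z, u))" by (intro continuous_intros)
    moreover have "continuous_on ((\<lambda>z. (z, u)) ` V) (\<lambda>(z, u). act X (t z) u)"
      by (rule continuous_on_subset[OF homeomorphism_cont1[OF h]]) (use zu(2) in auto)
    ultimately show "continuous_on V ?s" using continuous_on_compose by fastforce
    show "proj X (?s z) = z" if "z \<in> V" for z using pr[OF that] .
    fix j
    \<comment> \<open>The coefficients do not depend on \<open>z\<close>, so the translated frame is
      a constant combination of smooth fields.\<close>
    have "frame X (?s z) j = (\<Sum>i\<in>UNIV. spin_cover (gam X) u $ i $ j *\<^sub>R frame X (t z) i)" for z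
      using P zu(2) unfolding spin_structure_def by blast
    then show "smooth_field_along (charts X) (charts X) (\<lambda>x. x) V (\<lambda>z. frame X (?s z) j)"
      using smooth_field_along_sum[OF A V' finite, where I = UNIV and Z = "\<lambda>i z. frame X (t z) i"
          and r = "\<lambda>i. spin_cover (gam X) u $ i $ j"] t
      by (simp add: smooth_section_def)
  qed
  ultimately have "\<exists>s. s (proj X q) = q \<and> (\<exists>V. proj X q \<in> V \<and> smooth_section X V s)"
    using V by (intro exI[of _ ?s] exI[of _ V] conjI)
  from someI_ex[OF this] show ?thesis using that unfolding section_through_def by blast
qed

section \<open>Clifford relations and complex weights\<close>

lemma scaleR_smult: "r *\<^sub>R w = of_real r *s (w :: complex ^ 'k)"
  by (simp add: vec_eq_iff) (simp add: scaleR_conv_of_real)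

lemma linear_matrix_vector_complex: "linear (\<lambda>w. (M :: complex ^ 'k ^ 'l) *v w)"
  by (simp add: linear_iff matrix_vector_right_distrib scaleR_smult vector_scalar_commute)

lemma cliff_mat_apply: "cliff_mat \<gamma> a *v w = (\<Sum>i\<in>UNIV. a $ i *\<^sub>R (\<gamma> i *v w))"
proof -
  have "(\<Sum>j\<in>UNIV. (\<Sum>i\<in>UNIV. a $ i *\<^sub>R \<gamma> i $ p $ j) * w $ j)
     = (\<Sum>i\<in>UNIV. a $ i *\<^sub>R (\<Sum>j\<in>UNIV. \<gamma> i $ p $ j * w $ j))" for p
    unfolding sum_distrib_right scaleR_sum_right by (subst sum.swap) simp
  then show ?thesis by (simp add: vec_eq_iff matrix_vector_mult_def cliff_mat_def)
qed

lemma cliff_mat_apply2: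
  "cliff_mat \<gamma> a *v (cliff_mat \<gamma> b *v w) =
     (\<Sum>k\<in>UNIV. \<Sum>l\<in>UNIV. (a $ k * b $ l) *\<^sub>R (\<gamma> k *v (\<gamma> l *v w)))"
proof -
  have "\<gamma> k *v (cliff_mat \<gamma> b *v w) = (\<Sum>l\<in>UNIV. b $ l *\<^sub>R (\<gamma> k *v (\<gamma> l *v w)))" for k
    by (simp add: cliff_mat_apply linear_sum[OF linear_matrix_vector_complex]
      linear_scale[OF linear_matrix_vector_complex])
  then show ?thesis by (simp only: cliff_mat_apply[of \<gamma> a] scaleR_sum_right scaleR_scaleR)
qed

text \<open>Expanding both products over pairs of generators and exchanging the summation indices of
  one makes the anticommutators of the generators appear; only the diagonal survives.\<close>

lemma cliff_mat_anticommute: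
  assumes "spinor_module \<epsilon> \<gamma>"
  shows "cliff_mat \<gamma> a *v (cliff_mat \<gamma> b *v w) + cliff_mat \<gamma> b *v (cliff_mat \<gamma> a *v w) =
    (-2 * (\<Sum>i\<in>UNIV. \<epsilon> i * a $ i * b $ i)) *\<^sub>R w"
proof -
  have \<gamma>: "\<gamma> k *v (\<gamma> l *v w) + \<gamma> l *v (\<gamma> k *v w) = (if k = l then -2 * \<epsilon> k else 0) *\<^sub>R w" for k l
  proof -
    have "(\<gamma> k ** \<gamma> l + \<gamma> l ** \<gamma> k) *v w = ((if k = l then -2 * \<epsilon> k else 0) *\<^sub>R mat 1) *v w"
      using assms by (simp add: spinor_module_def)
    moreover have "(r *\<^sub>R mat 1) *v w = r *\<^sub>R w" for r
      by (simp add: vec_eq_iff matrix_vector_mult_def mat_def if_distrib[of "\<lambda>x. x * _"]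
          if_distrib[of "\<lambda>x. _ *\<^sub>R x"] cong: if_cong)
    ultimately show ?thesis by (simp add: matrix_vector_mult_add_rdistrib matrix_vector_mul_assoc)
  qed
  have "cliff_mat \<gamma> b *v (cliff_mat \<gamma> a *v w) =
     (\<Sum>k\<in>UNIV. \<Sum>l\<in>UNIV. (a $ k * b $ l) *\<^sub>R (\<gamma> l *v (\<gamma> k *v w)))"
    unfolding cliff_mat_apply2 by (subst sum.swap) (simp add: mult.commute)
  then have "cliff_mat \<gamma> a *v (cliff_mat \<gamma> b *v w) + cliff_mat \<gamma> b *v (cliff_mat \<gamma> a *v w) =
     (\<Sum>k\<in>UNIV. \<Sum>l\<in>UNIV. (a $ k * b $ l) *\<^sub>R (if k = l then -2 * \<epsilon> k else 0) *\<^sub>R w)"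
    by (simp add: cliff_mat_apply2 sum.distrib[symmetric] scaleR_right_distrib[symmetric] \<gamma>)
  also have "\<dots> = (\<Sum>k\<in>UNIV. (a $ k * b $ k * (-2 * \<epsilon> k)) *\<^sub>R w)"
    by (simp add: if_distrib[of "\<lambda>x. x *\<^sub>R _"] if_distrib[of "\<lambda>x. _ *\<^sub>R x"] cong: if_cong)
  finally show ?thesis
    by (simp add: scaleR_sum_left sum_distrib_left ac_simps)
qed

lemma frame_orthonormal:
  assumes "spin_mfd X"
  shows "orthonormal_wrt (signs X) (metric X (proj X q)) (frame X q)"
  using assms
  by (simp add: spin_mfd_def spin_structure_def orthonormal_wrt_def semi_riemannian_metric_def)

lemma spin_mfd_metric_bilinear: "spin_mfd X \<Longrightarrow> bilinear (metric X x)"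
  unfolding spin_mfd_def by (auto intro: semi_riemannian_bilinear)

lemma spin_mfd_metric_sym: "spin_mfd X \<Longrightarrow> metric X x v w = metric X x w v"
  unfolding spin_mfd_def by (auto intro: semi_riemannian_sym)

lemma linear_clifford_left:
  assumes "spin_mfd X" shows "linear (\<lambda>v. clifford X q v w)"
  unfolding clifford_def cliff_mat_apply
  by (simp add: linear_iff bilinear_ladd[OF spin_mfd_metric_bilinear[OF assms]]
      bilinear_lmul[OF spin_mfd_metric_bilinear[OF assms]] sum.distrib scaleR_sum_right
      algebra_simps)

lemma clifford_simps:
  "clifford X q v (w + w') = clifford X q v w + clifford X q v w'"
  "clifford X q v (w - w') = clifford X q v w - clifford X q v w'"
  "clifford X q v (c *s w) = c *s clifford X q v w"
  "clifford X q v (r *\<^sub>R w) = r *\<^sub>R clifford X q v w"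
  unfolding clifford_def
  by (simp_all add: linear_add[OF linear_matrix_vector_complex] linear_diff[OF linear_matrix_vector_complex]
      linear_scale[OF linear_matrix_vector_complex] vector_scalar_commute)

lemma clifford_anticommute:
  assumes X: "spin_mfd X"
  shows "clifford X q v (clifford X q u w) + clifford X q u (clifford X q v w) =
    (-2 * metric X (proj X q) v u) *\<^sub>R w"
proof -
  let ?g = "metric X (proj X q)" and ?e = "frame X q" and ?\<epsilon> = "signs X"
  note b = spin_mfd_metric_bilinear[OF X]
  have sq: "?\<epsilon> i * ?\<epsilon> i = 1" for i
    using frame_orthonormal[OF X, of q] unfolding orthonormal_wrt_def
    by (metis mult_1 mult_minus1 minus_minus)
  have l: "linear (?g u)" using b by (simp add: bilinear_def)
  \<comment> \<open>Expanding \<open>v\<close> in the frame expresses the metric by components;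
    \<open>sq\<close> supplies the additional signs contained in the components used by
    \<open>clifford\<close>.\<close>
  have "?g v u = ?g u (\<Sum>i\<in>UNIV. (?\<epsilon> i * ?g v (?e i)) *\<^sub>R ?e i)"
    using orthonormal_expansion[OF b frame_orthonormal[OF X], of v] spin_mfd_metric_sym[OF X] by simp
  also have "\<dots> = (\<Sum>i\<in>UNIV. ?\<epsilon> i * (?\<epsilon> i * ?g v (?e i)) * (?\<epsilon> i * ?g u (?e i)))"
    unfolding linear_sum[OF l] linear_scale[OF l] real_scaleR_def
  proof (intro sum.cong refl)
    fix i
    show "?\<epsilon> i * ?g v (?e i) * ?g u (?e i) = ?\<epsilon> i * (?\<epsilon> i * ?g v (?e i)) * (?\<epsilon> i * ?g u (?e i))"
      using sq[of i] by algebra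
  qed
  finally have "(\<Sum>i\<in>UNIV. ?\<epsilon> i * (?\<epsilon> i * ?g v (?e i)) * (?\<epsilon> i * ?g u (?e i))) = ?g v u" ..
  then show ?thesis
    using cliff_mat_anticommute[of ?\<epsilon> "gam X" "\<chi> i. ?\<epsilon> i * ?g v (?e i)" "\<chi> i. ?\<epsilon> i * ?g u (?e i)" w] X
    by (simp add: clifford_def spin_mfd_def)
qed

lemma bounded_bilinear_smult:
  "bounded_bilinear (\<lambda>(c::complex) (w::complex ^ 'k). c *s w)"
proof -
  have "bilinear (\<lambda>(c::complex) (w::complex ^ 'k). c *s w)"
    by (simp add: bilinear_def linear_iff vec_eq_iff algebra_simps)
  then show ?thesis by (simp add: bilinear_conv_bounded_bilinear)
qed

text \<open>The weight of the spinor field is complex, so its product rule uses complex scaling,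
  unlike the real one for vector fields.\<close>

lemma has_dir_deriv_exp_smult:
  fixes F :: "'x::topological_space \<Rightarrow> complex ^ 'k"
  assumes A: "smooth_atlas A" and d: "has_dir_deriv A \<sigma> x d" and D: "has_dir_deriv A F x D"
  shows "has_dir_deriv A (\<lambda>z. exp (c * of_real (\<sigma> z)) *s F z) x
    (\<lambda>v. exp (c * of_real (\<sigma> x)) *s (D v + (c * of_real (d v)) *s F x))"
proof -
  let ?i = "chart_inv (chart_at A x)" and ?p = "snd (chart_at A x) x"
  have i: "?i ?p = x" by (rule chart_inv_base[OF A])
  have "((\<lambda>p. of_real (\<sigma> (?i p)) :: complex) has_derivative (\<lambda>v. of_real (d v))) (at ?p)"
    using d unfolding has_dir_deriv_def comp_def by (rule has_derivative_of_real)
  then have 1: "((\<lambda>p. c * of_real (\<sigma> (?i p))) has_derivative (\<lambda>v. c * of_real (d v))) (at ?p)"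
    by (rule has_derivative_mult_right)
  have "((\<lambda>p. exp (c * of_real (\<sigma> (?i p)))) has_derivative
     (\<lambda>v. exp (c * of_real (\<sigma> x)) * (c * of_real (d v)))) (at ?p)"
    using has_derivative_compose[OF 1 has_field_derivative_imp_has_derivative[OF DERIV_exp]] i by simp
  from bounded_bilinear.FDERIV[OF bounded_bilinear_smult this D[unfolded has_dir_deriv_def comp_def]]
  show ?thesis unfolding has_dir_deriv_def comp_def
    by (rule has_derivative_eq_rhs) (simp add: i fun_eq_iff vec_eq_iff algebra_simps)
qed

section \<open>Conformal covariance\<close>

text \<open>The chosen section is smooth near \<open>x\<close>, so both derivatives entering
  \<open>spin_conn\<close> exist.\<close>

lemma
  fixes X :: "('x::topological_space, 'm::finite, 'q::topological_space, 'k::finite) spin_manifold"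
    and q :: 'q
  assumes X: "spin_mfd X"
  defines "x \<equiv> proj X q" and "s \<equiv> section_through X q"
  shows section_frame_derivative:
      "has_dir_deriv (charts X) (\<lambda>z. to_chart (charts X) (chart_at (charts X) x) z (frame X (s z) k)) x
        (dir_deriv (charts X) (\<lambda>z. to_chart (charts X) (chart_at (charts X) x) z (frame X (s z) k)) x)"
    and section_spinor_derivative: "spinor_field X \<theta> \<Longrightarrow>
      has_dir_deriv (charts X) (\<theta> \<circ> s) x (dir_deriv (charts X) (\<theta> \<circ> s) x)"
proof -
  have A: "smooth_atlas (charts X)" using X by (simp add: spin_mfd_def)
  obtain V where V: "x \<in> V" "smooth_section X V s"
    unfolding x_def s_def using section_through[OF X] .
  show "has_dir_deriv (charts X) (\<lambda>z. to_chart (charts X) (chart_at (charts X) x) z (frame X (s z) k)) x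
        (dir_deriv (charts X) (\<lambda>z. to_chart (charts X) (chart_at (charts X) x) z (frame X (s z) k)) x)"
    using V by (intro has_dir_deriv_smooth_field[OF A A, where f = "\<lambda>x. x"])
      (auto simp: smooth_section_def)
  show "has_dir_deriv (charts X) (\<theta> \<circ> s) x (dir_deriv (charts X) (\<theta> \<circ> s) x)" if "spinor_field X \<theta>"
    using V that by (intro has_dir_deriv_smooth_fun[OF A]) (auto simp: spinor_field_def)
qed

section \<open>The spinor connection\<close>

lemma linear_spin_conn:
  fixes X :: "('x::topological_space, 'm::finite, 'q::topological_space, 'k::finite) spin_manifold"
  assumes X: "spin_mfd X" and \<theta>: "spinor_field X \<theta>"
  shows "linear (spin_conn X \<theta> q)"
proof -
  let ?x = "proj X q" and ?s = "section_through X q"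
  have A: "smooth_atlas (charts X)" using X by (simp add: spin_mfd_def)
  note l = cov_along_linear[OF A A smooth_map_id[OF A] section_frame_derivative[OF X]]
  note b = spin_mfd_metric_bilinear[OF X]
  note d = has_dir_deriv_linear[OF section_spinor_derivative[OF X \<theta>]]
  have "linear (\<lambda>v. (c * metric X ?x (cov_along (charts X) (charts X) (metric X) (\<lambda>x. x)
      (\<lambda>z. frame X (?s z) k) ?x v) w) *\<^sub>R \<phi>)" for c k w and \<phi> :: "complex ^ 'k"
    by (simp add: linear_iff linear_add[OF l] linear_scale[OF l]
        bilinear_ladd[OF b] bilinear_lmul[OF b] algebra_simps)
  then show ?thesis
    unfolding spin_conn_def Let_def levi_civita_def
    by (intro linear_compose_add d linear_compose_scale_right linear_compose_sum ballI)
qed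

lemma levi_civita_conformal:
  fixes X :: "('x::topological_space, 'm::finite, 'q::topological_space, 'k::finite) spin_manifold"
    and q :: 'q
  assumes X: "spin_mfd X" and \<sigma>: "smooth_fun (charts X) UNIV \<sigma>"
  defines "x \<equiv> proj X q" and "s \<equiv> section_through X q" and "A \<equiv> charts X"
  shows "levi_civita (charts (conformal \<sigma> X)) (metric (conformal \<sigma> X))
      (\<lambda>z. frame (conformal \<sigma> X) (s z) k) x v =
    exp (- \<sigma> x) *\<^sub>R (levi_civita A (metric X) (\<lambda>z. frame X (s z) k) x v
      + dir_deriv A \<sigma> x (frame X q k) *\<^sub>R v
      - metric X x v (frame X q k) *\<^sub>R grad A (metric X) \<sigma> x)"
proof -
  have A: "smooth_atlas A" and g: "semi_riemannian_metric A (signs X) (metric X)"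
    using X by (simp_all add: spin_mfd_def A_def)
  note id = smooth_map_id[OF A] and \<sigma>' = \<sigma>[folded A_def]
  note F = section_frame_derivative[OF X, of q k, folded x_def s_def A_def]
  obtain V where V: "x \<in> V" "smooth_section X V s" and sx: "s x = q"
    unfolding x_def s_def using section_through[OF X] .
  have "levi_civita (charts (conformal \<sigma> X)) (metric (conformal \<sigma> X))
      (\<lambda>z. frame (conformal \<sigma> X) (s z) k) x v
    = cov_along A A (\<lambda>x v w. exp (2 * \<sigma> x) * metric X x v w) (\<lambda>x. x)
      (\<lambda>z. exp (- \<sigma> (proj X (s z))) *\<^sub>R frame X (s z) k) x v"
    by (simp add: levi_civita_def conformal_def A_def)
  \<comment> \<open>The new frame is scaled by \<sigma> at \<open>proj X (s z)\<close>, which is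
    known to equal \<open>z\<close> on the domain \<open>V\<close> of the section; hence the passage
    through \<open>cov_along_cong\<close>.\<close>
  also have "\<dots> = cov_along A A (\<lambda>x v w. exp (2 * \<sigma> x) * metric X x v w) (\<lambda>x. x)
      (\<lambda>z. exp (-1 * \<sigma> z) *\<^sub>R frame X (s z) k) x v"
    by (rule cov_along_cong[OF A has_dir_deriv_to_chart_scale[OF A A id \<sigma>' F]])
      (use V in \<open>auto simp: smooth_section_def\<close>)
  also have "\<dots> = exp (- \<sigma> x) *\<^sub>R (levi_civita A (metric X) (\<lambda>z. frame X (s z) k) x v
      + dir_deriv A \<sigma> x (frame X q k) *\<^sub>R v
      - metric X x v (frame X q k) *\<^sub>R grad A (metric X) \<sigma> x)"
    using cov_along_conformal[OF A A id g \<sigma>' F, of v]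
    by (simp add: differential_id[OF A] levi_civita_def sx)
  finally show ?thesis .
qed

text \<open>The change of the connection form is skew in the frame indices and contributes
  \<open>1/4 (G\<cdot>v - v\<cdot>G)\<cdot>\<theta>\<close>. The Clifford relation rewrites this as
  \<open>- 1/2 v\<cdot>G\<cdot>\<theta> - 1/2 g(v,G)\<theta>\<close>, and differentiating the weight
  adds \<open>lam\<close> times \<open>g(v,G)\<theta>\<close>.\<close>

lemma spin_conn_conformal:
  fixes X :: "('x::topological_space, 'm::finite, 'q::topological_space, 'k::finite) spin_manifold"
    and q :: 'q
  assumes X: "spin_mfd X" and \<sigma>: "smooth_fun (charts X) UNIV \<sigma>" and \<theta>: "spinor_field X \<theta>"
  defines "x \<equiv> proj X q"
  defines "G \<equiv> grad (charts X) (metric X) \<sigma> x"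
  shows "spin_conn (conformal \<sigma> X) (\<lambda>p. exp (lam * of_real (\<sigma> (proj X p))) *s \<theta> p) q v =
    exp (lam * of_real (\<sigma> x)) *s (spin_conn X \<theta> q v - (1/2) *\<^sub>R clifford X q v (clifford X q G (\<theta> q))
      + ((lam - 1/2) * of_real (metric X x v G)) *s \<theta> q)"
proof -
  let ?A = "charts X" and ?g = "metric X x" and ?e = "frame X q" and ?\<epsilon> = "signs X" and ?\<gamma> = "gam X"
  let ?E = "exp (lam * of_real (\<sigma> x))" and ?\<psi> = "\<lambda>p. exp (lam * of_real (\<sigma> (proj X p))) *s \<theta> p"
  define s where "s = section_through X q"
  define \<omega> where "\<omega> = (\<lambda>k l. ?g (levi_civita ?A (metric X) (\<lambda>z. frame X (s z) k) x v) (?e l))"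
  have A: "smooth_atlas ?A" and g: "semi_riemannian_metric ?A ?\<epsilon> (metric X)"
    using X by (simp_all add: spin_mfd_def)
  have ds: "dir_deriv ?A \<sigma> x w = ?g G w" for w
    using metric_grad[OF A g \<sigma>] semi_riemannian_sym[OF g] unfolding G_def by metis
  note b = spin_mfd_metric_bilinear[OF X]
  obtain V where V: "x \<in> V" "smooth_section X V s" and sx: "s x = q"
    unfolding x_def s_def using section_through[OF X] .
  have dpsi: "dir_deriv ?A (?\<psi> \<circ> s) x v = ?E *s (dir_deriv ?A (\<theta> \<circ> s) x v
      + (lam * of_real (?g G v)) *s \<theta> q)"
  proof -
    have "has_dir_deriv ?A (\<lambda>z. exp (lam * of_real (\<sigma> z)) *s (\<theta> \<circ> s) z) x
        (\<lambda>v. ?E *s (dir_deriv ?A (\<theta> \<circ> s) x v + (lam * of_real (dir_deriv ?A \<sigma> x v)) *s (\<theta> \<circ> s) x))"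
      by (rule has_dir_deriv_exp_smult[OF A has_dir_deriv_smooth_fun[OF A \<sigma> UNIV_I]
            section_spinor_derivative[OF X \<theta>, of q, folded x_def s_def]])
    then have "has_dir_deriv ?A (?\<psi> \<circ> s) x
        (\<lambda>v. ?E *s (dir_deriv ?A (\<theta> \<circ> s) x v + (lam * of_real (dir_deriv ?A \<sigma> x v)) *s (\<theta> \<circ> s) x))"
      by (rule has_dir_deriv_cong[OF A, where V = V]) (use V in \<open>auto simp: smooth_section_def\<close>)
    from fun_cong[OF has_dir_deriv_eq[OF this], of v] show ?thesis by (simp add: ds sx)
  qed
  \<comment> \<open>The factor \<open>exp (2 * \<sigma> x)\<close> of the metric cancels the two
    factors \<open>exp (- \<sigma> x)\<close> from the differentiated and the paired frame
    vector.\<close>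
  have om: "metric (conformal \<sigma> X) x (levi_civita (charts (conformal \<sigma> X)) (metric (conformal \<sigma> X))
      (\<lambda>z. frame (conformal \<sigma> X) (s z) k) x v) (frame (conformal \<sigma> X) q l)
    = \<omega> k l + (?g G (?e k) * ?g v (?e l) - ?g v (?e k) * ?g G (?e l))" for k l
  proof -
    have e: "exp (2 * \<sigma> x) * exp (- \<sigma> x) * exp (- \<sigma> x) = 1"
      by (simp add: exp_add[symmetric])
    show ?thesis
      unfolding levi_civita_conformal[OF X \<sigma>, of q, folded x_def s_def, folded G_def]
      by (simp add: conformal_def x_def[symmetric] bilinear_lmul[OF b] bilinear_rmul[OF b]
          bilinear_ladd[OF b] bilinear_lsub[OF b] ds \<omega>_def) (use e in algebra)
  qed
  \<comment> \<open>Two successive Clifford multiplications have the same double-sum shape as the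
    connection term, so the extra part of \<open>om\<close> can be read off as a commutator.\<close>
  have c: "clifford X q a (clifford X q b w) = (\<Sum>k\<in>UNIV. \<Sum>l\<in>UNIV.
      (?\<epsilon> k * ?\<epsilon> l * (?g a (?e k) * ?g b (?e l))) *\<^sub>R (?\<gamma> k *v (?\<gamma> l *v w)))" for a b w
    unfolding clifford_def cliff_mat_apply2 x_def by (simp add: ac_simps)
  let ?P = "\<lambda>k l w. ?\<gamma> k *v (?\<gamma> l *v w)"
  have "(\<Sum>k\<in>UNIV. \<Sum>l\<in>UNIV. (?\<epsilon> k * ?\<epsilon> l * (\<omega> k l + (?g G (?e k) * ?g v (?e l) - ?g v (?e k) * ?g G (?e l))))
        *\<^sub>R ?P k l (?E *s \<theta> q))
     = ?E *s ((\<Sum>k\<in>UNIV. \<Sum>l\<in>UNIV. (?\<epsilon> k * ?\<epsilon> l * \<omega> k l) *\<^sub>R ?P k l (\<theta> q))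
       + (clifford X q G (clifford X q v (\<theta> q)) - clifford X q v (clifford X q G (\<theta> q))))"
    unfolding c sum.distrib[symmetric] sum_subtractf[symmetric]
      vec.scale_sum_right
    by (intro sum.cong refl)
      (simp add: vector_scalar_commute scaleR_smult algebra_simps vec.scale_right_distrib vec.scale_right_diff_distrib
        vec.scale_left_distrib vec.scale_left_diff_distrib)
  then have "spin_conn (conformal \<sigma> X) ?\<psi> q v = ?E *s (dir_deriv ?A (\<theta> \<circ> s) x v
      + (lam * of_real (?g G v)) *s \<theta> q) + (1/4) *\<^sub>R
     (?E *s ((\<Sum>k\<in>UNIV. \<Sum>l\<in>UNIV. (?\<epsilon> k * ?\<epsilon> l * \<omega> k l) *\<^sub>R ?P k l (\<theta> q))
       + (clifford X q G (clifford X q v (\<theta> q)) - clifford X q v (clifford X q G (\<theta> q)))))"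
    unfolding spin_conn_def[of "conformal \<sigma> X"] Let_def section_through_conformal[OF A \<sigma>]
      s_def[symmetric]
    using om dpsi by (simp add: conformal_def x_def)
  moreover have "spin_conn X \<theta> q v = dir_deriv ?A (\<theta> \<circ> s) x v
     + (1/4) *\<^sub>R (\<Sum>k\<in>UNIV. \<Sum>l\<in>UNIV. (?\<epsilon> k * ?\<epsilon> l * \<omega> k l) *\<^sub>R ?P k l (\<theta> q))"
    by (simp add: spin_conn_def Let_def \<omega>_def s_def x_def)
  moreover have "clifford X q G (clifford X q v (\<theta> q)) =
      (-2 * ?g v G) *\<^sub>R \<theta> q - clifford X q v (clifford X q G (\<theta> q))"
    using clifford_anticommute[OF X, of q v G "\<theta> q"] by (simp add: x_def algebra_simps)
  moreover have "?g G v = ?g v G" by (rule spin_mfd_metric_sym[OF X])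
  ultimately show ?thesis
    by (simp add: scaleR_smult vec_eq_iff) (simp add: field_simps)
qed

section \<open>The Dirac operator\<close>

lemma clifford_conformal_scaled:
  fixes X :: "('x::topological_space, 'm::finite, 'q::topological_space, 'k::finite) spin_manifold"
  assumes "spin_mfd X"
  shows "clifford (conformal \<sigma> X) q (exp (- \<sigma> (proj X q)) *\<^sub>R v) w = clifford X q v w"
  using clifford_conformal[OF assms, of \<sigma> q v "\<lambda>_. w"] by (simp add: hat_def)

text \<open>Since \<open>e\<^sub>i\<cdot>e\<^sub>i\<close> acts as
  \<open>- \<epsilon>\<^sub>i\<close>, each frame vector contributes
  \<open>1/2 G\<cdot>\<theta>\<close> through the term
  \<open>- 1/2 v\<cdot>G\<cdot>\<theta>\<close>. The terms with \<open>g(e\<^sub>i,G)\<close>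
  reassemble \<open>G\<close> and contribute \<open>(lam - 1/2) G\<cdot>\<theta>\<close>.\<close>

lemma dirac_conformal:
  fixes X :: "('x::topological_space, 'm::finite, 'q::topological_space, 'k::finite) spin_manifold"
    and q :: 'q
  assumes X: "spin_mfd X" and \<sigma>: "smooth_fun (charts X) UNIV \<sigma>" and \<theta>: "spinor_field X \<theta>"
  defines "x \<equiv> proj X q"
  defines "G \<equiv> grad (charts X) (metric X) \<sigma> x"
  shows "dirac (conformal \<sigma> X) (\<lambda>p. exp (lam * of_real (\<sigma> (proj X p))) *s \<theta> p) q =
    (of_real (exp (- \<sigma> x)) * exp (lam * of_real (\<sigma> x))) *s (dirac X \<theta> q
      + (lam + (of_nat CARD('m) - 1) / 2) *s clifford X q G (\<theta> q))"
proof -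
  let ?g = "metric X x" and ?e = "frame X q" and ?\<epsilon> = "signs X"
  let ?K = "of_real (exp (- \<sigma> x)) * exp (lam * of_real (\<sigma> x))"
  let ?\<psi> = "\<lambda>p. exp (lam * of_real (\<sigma> (proj X p))) *s \<theta> p"
  note b = spin_mfd_metric_bilinear[OF X]
  have on: "orthonormal_wrt ?\<epsilon> ?g ?e" using frame_orthonormal[OF X, of q] by (simp add: x_def)
  have sq: "?\<epsilon> i * ?\<epsilon> i = 1" for i
    using on unfolding orthonormal_wrt_def by (metis mult_1 mult_minus1 minus_minus)
  have conn: "spin_conn (conformal \<sigma> X) ?\<psi> q (exp (- \<sigma> x) *\<^sub>R v) =
     ?K *s (spin_conn X \<theta> q v - (1/2) *\<^sub>R clifford X q v (clifford X q G (\<theta> q))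
      + ((lam - 1/2) * of_real (?g v G)) *s \<theta> q)" for v
    unfolding spin_conn_conformal[OF X \<sigma> \<theta>, of lam q, folded x_def, folded G_def]
    by (simp add: linear_scale[OF linear_spin_conn[OF X \<theta>]] linear_scale[OF linear_clifford_left[OF X]]
        bilinear_lmul[OF b] scaleR_smult vec_eq_iff algebra_simps)
  have ee: "clifford X q (?e i) (clifford X q (?e i) w) = (- ?\<epsilon> i) *\<^sub>R w" for i w
  proof -
    have "2 *\<^sub>R clifford X q (?e i) (clifford X q (?e i) w) = 2 *\<^sub>R ((- ?\<epsilon> i) *\<^sub>R w)"
      using clifford_anticommute[OF X, of q "?e i" "?e i" w] on
      by (simp add: orthonormal_wrt_def x_def scaleR_2)
    then show ?thesis by (metis scaleR_cancel_left zero_neq_numeral)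
  qed
  have "(\<Sum>i\<in>UNIV. (?\<epsilon> i * ?g (?e i) G) *\<^sub>R clifford X q (?e i) w)
     = clifford X q (\<Sum>i\<in>UNIV. (?\<epsilon> i * ?g G (?e i)) *\<^sub>R ?e i) w" for w
    by (simp add: linear_sum[OF linear_clifford_left[OF X]] linear_scale[OF linear_clifford_left[OF X]]
        spin_mfd_metric_sym[OF X, of _ G])
  then have G: "(\<Sum>i\<in>UNIV. (?\<epsilon> i * ?g (?e i) G) *\<^sub>R clifford X q (?e i) w) = clifford X q G w" for w
    using orthonormal_expansion[OF b on, of G] by simp
  have "dirac (conformal \<sigma> X) ?\<psi> q = (\<Sum>i\<in>UNIV. ?\<epsilon> i *\<^sub>R clifford X q (?e i)
     (?K *s (spin_conn X \<theta> q (?e i) - (1/2) *\<^sub>R clifford X q (?e i) (clifford X q G (\<theta> q))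
      + ((lam - 1/2) * of_real (?g (?e i) G)) *s \<theta> q)))"
    unfolding dirac_def
    \<comment> \<open>Only the fields \<open>signs\<close> and \<open>frame\<close> are unfolded, so
      that \<open>clifford\<close> and \<open>spin_conn\<close> of the changed manifold stay intact
      for their own rewrite rules.\<close>
    by (simp add: conformal_def[of \<sigma> X, THEN arg_cong, of signs] conformal_def[of \<sigma> X, THEN arg_cong, of frame]
        clifford_conformal_scaled[OF X] conn[unfolded x_def] x_def)
  also have "\<dots> = (\<Sum>i\<in>UNIV. ?K *s (?\<epsilon> i *\<^sub>R clifford X q (?e i) (spin_conn X \<theta> q (?e i))
       + (1/2) *s clifford X q G (\<theta> q)
       + (lam - 1/2) *s ((?\<epsilon> i * ?g (?e i) G) *\<^sub>R clifford X q (?e i) (\<theta> q))))"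
  proof (intro sum.cong refl)
    fix i
    have "complex_of_real (?\<epsilon> i) * (complex_of_real (?\<epsilon> i) * c) = c" for c
      using sq[of i] by (metis mult.assoc mult_1 of_real_1 of_real_mult)
    then show "?\<epsilon> i *\<^sub>R clifford X q (?e i)
     (?K *s (spin_conn X \<theta> q (?e i) - (1/2) *\<^sub>R clifford X q (?e i) (clifford X q G (\<theta> q))
      + ((lam - 1/2) * of_real (?g (?e i) G)) *s \<theta> q)) =
      ?K *s (?\<epsilon> i *\<^sub>R clifford X q (?e i) (spin_conn X \<theta> q (?e i))
       + (1/2) *s clifford X q G (\<theta> q)
       + (lam - 1/2) *s ((?\<epsilon> i * ?g (?e i) G) *\<^sub>R clifford X q (?e i) (\<theta> q)))"
      by (simp add: clifford_simps ee) (simp add: scaleR_smult vec_eq_iff algebra_simps)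
  qed
  also have "\<dots> = ?K *s (dirac X \<theta> q + (of_nat CARD('m) * (1/2)) *s clifford X q G (\<theta> q)
     + (lam - 1/2) *s clifford X q G (\<theta> q))"
    unfolding vec.scale_sum_right[symmetric] sum.distrib G dirac_def
      sum_constant_scaleR
    by (simp add: scaleR_smult vec_eq_iff)
  also have "\<dots> = ?K *s (dirac X \<theta> q + (lam + (of_nat CARD('m) - 1) / 2) *s clifford X q G (\<theta> q))"
    by (simp add: vec_eq_iff algebra_simps diff_divide_distrib)
  finally show ?thesis .
qed

theorem proposition4p4:
  fixes X :: "('x::{second_countable_topology,t2_space}, 'm::finite, 'q::topological_space, 'k::finite)
                spin_manifold"
    and M :: "('x, 'm, 'y::{second_countable_topology,t2_space}, 'n::finite) hypersurface"
    and \<sigma> :: "'x \<Rightarrow> real" and lam :: complex and \<theta> :: "'q \<Rightarrow> complex ^ 'k"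
    and y :: 'y and q :: 'q
  assumes "spin_mfd X"
    and "hypersurface_in X M"
    and "smooth_fun (charts X) UNIV \<sigma>"
    and "spinor_field X \<theta>"
    and "proj X q = emb M y"
  shows "exp (- ((lam - 1) * of_real (\<sigma> (emb M y)))) *s
           D1 (conformal \<sigma> X) (conformal_hyp \<sigma> M) lam
             (\<lambda>p. exp (lam * of_real (\<sigma> (proj X p))) *s hat \<theta> p) (y, q)
         = hat (D1 X M lam \<theta>) (y, q)"
proof -
  note X = assms(1) and M = assms(2) and \<sigma> = assms(3) and \<theta> = assms(4) and q = assms(5)
  let ?x = "emb M y" and ?N = "normal M y" and ?n = "of_nat CARD('n) :: complex"
  let ?\<psi> = "\<lambda>p. exp (lam * of_real (\<sigma> (proj X p))) *s \<theta> p"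
  define G where "G = grad (charts X) (metric X) \<sigma> ?x"
  define a where "a = complex_of_real (exp (- \<sigma> ?x))"
  define E where "E = exp (lam * of_real (\<sigma> ?x))"
  define d where "d = metric X ?x ?N G"
  have A: "smooth_atlas (charts X)" and g: "semi_riemannian_metric (charts X) (signs X) (metric X)"
    using X by (simp_all add: spin_mfd_def)
  have card: "CARD('m) = CARD('n) + 1" using M by (simp add: hypersurface_in_def)
  \<comment> \<open>\<open>a * E\<close> is the weight \<open>exp ((lam - 1) * \<sigma>)\<close>;
    each summand of \<open>D1\<close> carries one factor \<open>a\<close>, from rescaled unit
    vectors or from the mean curvature.\<close>
  have unit: "exp (- ((lam - 1) * of_real (\<sigma> ?x))) * (a * E) = 1"
    by (simp add: a_def E_def exp_of_real[symmetric] exp_add[symmetric] algebra_simps)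
  \<comment> \<open>The hypersurface has codimension one, so \<open>CARD('m) - 1\<close> in
    \<open>dirac_conformal\<close> becomes \<open>n\<close>.\<close>
  have D: "dirac (conformal \<sigma> X) ?\<psi> q = (a * E) *s (dirac X \<theta> q + (lam + ?n / 2) *s clifford X q G (\<theta> q))"
    using dirac_conformal[OF X \<sigma> \<theta>, of lam q] by (simp add: q G_def a_def E_def card)
  have C: "spin_conn (conformal \<sigma> X) ?\<psi> q (exp (- \<sigma> ?x) *\<^sub>R ?N) =
     (a * E) *s (spin_conn X \<theta> q ?N - (1/2) *\<^sub>R clifford X q ?N (clifford X q G (\<theta> q))
      + ((lam - 1/2) * of_real d) *s \<theta> q)"
    unfolding spin_conn_conformal[OF X \<sigma> \<theta>, of lam q] q
    by (simp add: linear_scale[OF linear_spin_conn[OF X \<theta>]] linear_scale[OF linear_clifford_left[OF X]]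
        bilinear_lmul[OF spin_mfd_metric_bilinear[OF X]] scaleR_smult vec_eq_iff algebra_simps
        a_def E_def d_def G_def)
  have H: "complex_of_real (mean_curvature (conformal \<sigma> X) (conformal_hyp \<sigma> M) y) =
      a * (of_real (mean_curvature X M y) - of_real d)"
    using mean_curvature_conformal[OF X M \<sigma>, of y] metric_grad[OF A g \<sigma>, of ?x ?N]
    by (simp add: a_def d_def G_def)
  have N: "normal (conformal_hyp \<sigma> M) y = exp (- \<sigma> ?x) *\<^sub>R ?N"
    by (simp add: conformal_hyp_def)
  have cl: "clifford (conformal \<sigma> X) q (exp (- \<sigma> ?x) *\<^sub>R ?N) w = clifford X q ?N w" for w
    using clifford_conformal_scaled[OF X, of \<sigma> q] by (simp add: q)
  \<comment> \<open>Here \<open>N\<cdot>G\<cdot>\<theta>\<close> has total coefficient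
    \<open>(lam + n/2) - (2 * lam + n)/2 = 0\<close>, and the \<open>d\<close>-terms of the
    connection and of the mean curvature carry the same factor
    \<open>(2 * lam + n) * (lam - 1/2)\<close> with opposite signs.\<close>
  have "D1 (conformal \<sigma> X) (conformal_hyp \<sigma> M) lam ?\<psi> (y, q) = (a * E) *s D1 X M lam \<theta> (y, q)"
    unfolding D1_def Let_def prod.case N cl D C H clifford_simps
    by (simp add: q E_def[symmetric] scaleR_smult vec_eq_iff) (simp add: field_simps)
  then show ?thesis
    using unit by (simp add: hat_def)
qed

end
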